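(* Let $(\xi_i)_{i\ge1}$ be i.i.d. random variables with $\mathbb{E}(\xi_i)=0$ and $\mathbb{E}(\xi_i^2)=1$, and let $S_t=\sum_{s=1}^t\xi_s$. For $b\ge1$ let $\tau_b=\inf\{t:|S_t|\ge b\}$ and $\sigma_b=\inf\{t:S_t=b\}$. Let $(W(t))_{t\ge0}$ be standard one-dimensional Brownian motion, and let $T=\inf\{t:|W(t)|=1\}$ and $S=\inf\{t:W(t)=1\}$. Then for every $\theta>0$, $$\lim_{b\to\infty}\mathbb{E}\big(e^{-\theta\tau_b/b^2}\big)=\mathbb{E}(e^{-\theta T})=\operatorname{sech}\sqrt{2\theta},$$ and $$\lim_{b\to\infty}\mathbb{E}\big(e^{-\theta\sigma_b/b^2}\big)=\mathbb{E}(e^{-\theta S})=\exp(-\sqrt{2\theta}).$$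
   Context: Here $\operatorname{sech}\theta=(\cosh\theta)^{-1}=\frac{2}{e^\theta+e^{-\theta}}$. The time index $t$ of the walk $S_t$ is a nonnegative integer, and standard Brownian motion is started at $0$.
   Formalization: The second limit fails for general steps (e.g. uniform on [-√3,√3], where S_t=b has probability 0); it is proved for inf{t: S_t≥b} for all step laws, and for σ_b=inf{t: S_t=b} when the steps are lattice with span h and b→∞ through multiples of h. *)

theory Defs
  imports "HOL-Probability.Probability"
begin

definition sech :: "real \<Rightarrow> real" where
  "sech x = inverse (cosh x)"

lemma sech_altdef: "sech x = 2 / (exp x + exp (- x))"
  by (simp add: sech_def cosh_def field_simps)

text \<open>The function \<open>x \<mapsto> e\<^sup>-\<^sup>x\<close> on extended reals, with \<open>e\<^sup>-\<^sup>\<infinity> = 0\<close>; hitting times may be infinite.\<close>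

definition exp_neg :: "ereal \<Rightarrow> real" where
  "exp_neg x = (if x = \<infinity> then 0 else exp (- real_of_ereal x))"

definition random_walk :: "(nat \<Rightarrow> 'a \<Rightarrow> real) \<Rightarrow> nat \<Rightarrow> 'a \<Rightarrow> real" where
  "random_walk \<xi> t \<omega> = (\<Sum>s=1..t. \<xi> s \<omega>)"

text \<open>Both infima are taken in \<open>ereal\<close>, so they are \<open>\<infinity>\<close> if the set is never hit.\<close>

definition walk_hitting_time :: "(nat \<Rightarrow> 'a \<Rightarrow> real) \<Rightarrow> real set \<Rightarrow> 'a \<Rightarrow> ereal" where
  "walk_hitting_time S A \<omega> = (INF t\<in>{t. S t \<omega> \<in> A}. ereal (real t))"

definition process_hitting_time :: "(real \<Rightarrow> 'a \<Rightarrow> real) \<Rightarrow> real set \<Rightarrow> 'a \<Rightarrow> ereal" where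
  "process_hitting_time W A \<omega> = (INF t\<in>{t. 0 \<le> t \<and> W t \<omega> \<in> A}. ereal t)"

text \<open>The step variables carry the indices \<open>1, 2, \<dots>\<close>; the value of \<open>\<xi>\<close> at index \<open>0\<close> is unconstrained.\<close>

definition iid_standardized :: "'a measure \<Rightarrow> (nat \<Rightarrow> 'a \<Rightarrow> real) \<Rightarrow> bool" where
  "iid_standardized M \<xi> \<longleftrightarrow>
     prob_space M \<and>
     prob_space.indep_vars M (\<lambda>_. borel) \<xi> {1..} \<and>
     (\<forall>i\<ge>1. distr M borel (\<xi> i) = distr M borel (\<xi> 1)) \<and>
     (\<forall>i\<ge>1. has_bochner_integral M (\<xi> i) 0) \<and>
     (\<forall>i\<ge>1. has_bochner_integral M (\<lambda>\<omega>. (\<xi> i \<omega>)\<^sup>2) 1)"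

text \<open>\<open>h\<close> is the span of the law of \<open>X\<close>: the largest \<open>h > 0\<close> such that \<open>X\<close> almost surely takes
  values in \<open>h\<int>\<close>. There is no such \<open>h\<close> if the law of \<open>X\<close> is not supported on any \<open>h\<int>\<close>.\<close>

definition has_lattice_span :: "'a measure \<Rightarrow> ('a \<Rightarrow> real) \<Rightarrow> real \<Rightarrow> bool" where
  "has_lattice_span M X h \<longleftrightarrow>
     h > 0 \<and> (AE \<omega> in M. X \<omega> / h \<in> \<int>) \<and>
     (\<forall>h'>0. (AE \<omega> in M. X \<omega> / h' \<in> \<int>) \<longrightarrow> h' \<le> h)"

text \<open>All paths, not just almost all, are required to be continuous, so that hitting times of
  closed sets are measurable even if \<open>N\<close> is not complete. The second parameter of
  \<open>normal_density\<close> is the standard deviation.\<close>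

definition standard_brownian_motion :: "'b measure \<Rightarrow> (real \<Rightarrow> 'b \<Rightarrow> real) \<Rightarrow> bool" where
  "standard_brownian_motion N W \<longleftrightarrow>
     prob_space N \<and>
     (\<forall>t\<ge>0. W t \<in> borel_measurable N) \<and>
     (AE \<omega> in N. W 0 \<omega> = 0) \<and>
     (\<forall>(n::nat) t. 0 \<le> t 0 \<longrightarrow> (\<forall>i<n. t i \<le> t (Suc i)) \<longrightarrow>
        prob_space.indep_vars N (\<lambda>_. borel) (\<lambda>i \<omega>. W (t (Suc i)) \<omega> - W (t i) \<omega>) {..<n}) \<and>
     (\<forall>s t. 0 \<le> s \<longrightarrow> s < t \<longrightarrow>
        distributed N lborel (\<lambda>\<omega>. W t \<omega> - W s \<omega>) (\<lambda>x. ennreal (normal_density 0 (sqrt (t - s)) x))) \<and>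
     (\<forall>\<omega>\<in>space N. continuous_on {0..} (\<lambda>t. W t \<omega>))"

end

theory Submission
  imports Defs
begin

text \<open>
  Everything rests on one discrete optional stopping estimate. Let \<open>\<tau>\<close> be the exit time of the walk
  from a set \<open>D\<close>, and let \<open>v\<close> be bounded, within \<open>\<delta>\<close> of solving \<open>e\<^sup>-\<^sup>l \<cdot> E v(x + \<xi>) = v(x)\<close> on \<open>D\<close>
  and within \<open>\<epsilon>\<close> of \<open>1\<close> off \<open>D\<close>. The stopped process \<open>e\<^sup>-\<^sup>l\<^sup>t v(S\<^sub>t)\<close> then drifts by at most
  \<open>\<delta> e\<^sup>-\<^sup>l\<^sup>t\<close> at step \<open>t\<close>, so that \<open>v(0)\<close> differs from \<open>E e\<^sup>-\<^sup>l\<^sup>\<tau>\<close> by at most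
  \<open>\<delta> / (1 - e\<^sup>-\<^sup>l) + \<epsilon>\<close> (\<open>expectation_discounted_hit\<close>). With \<open>l = \<theta> / b\<^sup>2\<close> it suffices to
  find, for each hitting problem, a \<open>v\<close> for which \<open>b\<^sup>2 \<delta>\<close> and \<open>\<epsilon>\<close> become arbitrarily small.

  For \<open>|S| \<ge> b\<close> and \<open>S \<ge> b\<close> take \<open>v(x) = g(x / b)\<close>, where \<open>g'' = 2 \<theta> g\<close> and \<open>g = 1\<close> on the
  boundary, that is \<open>g(x) = cosh(\<surd>(2\<theta>) x) / cosh \<surd>(2\<theta>)\<close> or \<open>g(x) = exp(\<surd>(2\<theta>) (x - 1))\<close>. As the
  steps have mean \<open>0\<close> and variance \<open>1\<close>, Taylor's formula gives the one-step equation up to an error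
  that is small compared with \<open>b\<^sup>-\<^sup>2\<close>. Replacing \<open>g\<close> by \<open>1\<close> at distance more than \<open>\<epsilon>\<close> from the
  region controls large overshoots: they are caused by steps exceeding \<open>\<epsilon> b\<close>, which carry a vanishing part of the second
  moment (\<open>hitting_transform_limit\<close>). The limits are \<open>g(0)\<close>.

  The error depends on the walk only through its step law, so these limits hold also along a sequence
  of different walks with the same law. Sampling Brownian motion at times \<open>k / n\<close> and multiplying by
  \<open>\<surd>n\<close> gives such a sequence of Gaussian walks. The sampled path reaches the level \<open>1\<close> no earlier than
  \<open>W\<close> does, and a level \<open>c < 1\<close> not much later, which squeezes \<open>E e\<^sup>-\<^sup>\<theta>\<^sup>T\<close> and \<open>E e\<^sup>-\<^sup>\<theta>\<^sup>S\<close> between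
  values of the same limit at \<open>\<theta>\<close> and \<open>\<theta> c\<^sup>2\<close> (\<open>brownian_hitting_transform\<close>).

  For hitting the point \<open>b\<close> exactly, let \<open>G\<close> be the discounted Green's function of the lattice walk,
  given as a Fourier integral of \<open>1 / (1 - e\<^sup>-\<^sup>l \<phi>(u))\<close> over \<open>|u| \<le> \<pi> / h\<close>. Then
  \<open>v(x) = G(b - x) / G(0)\<close> solves the one-step equation exactly away from \<open>b\<close>, and so
  \<open>E e\<^sup>-\<^sup>l\<^sup>\<sigma> = v(0)\<close>. The same \<open>v\<close>, truncated, almost solves the half-line problem: since \<open>h\<close> is the
  span of the law, \<open>1 - e\<^sup>-\<^sup>l \<phi>(u)\<close> is of exact order \<open>l + u\<^sup>2\<close> on the domain of integration, and hence
  \<open>v\<close> is close to \<open>1\<close> at all points within \<open>\<epsilon> b\<close> of \<open>b\<close>. Thus hitting \<open>b\<close> exactly and passing \<open>b\<close> have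
  asymptotically the same transform (\<open>lattice_point_vs_half_line\<close>).
\<close>

section \<open>Random walks with a given step law\<close>

lemma random_walk_0 [simp]: "random_walk \<xi> 0 \<omega> = 0"
  by (simp add: random_walk_def)

lemma random_walk_Suc [simp]: "random_walk \<xi> (Suc t) \<omega> = random_walk \<xi> t \<omega> + \<xi> (Suc t) \<omega>"
  by (simp add: random_walk_def)

lemma exp_neg_walk_hitting_time:
  assumes "l > 0"
  shows "exp_neg (ereal l * walk_hitting_time S A \<omega>) =
    (if \<exists>t. S t \<omega> \<in> A then exp (- l * real (LEAST t. S t \<omega> \<in> A)) else 0)"
proof (cases "\<exists>t. S t \<omega> \<in> A")
  case True
  define k where "k = (LEAST t. S t \<omega> \<in> A)"
  have k: "S k \<omega> \<in> A" unfolding k_def using True by (rule LeastI_ex)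
  have "k \<le> t" if "S t \<omega> \<in> A" for t unfolding k_def using that by (rule Least_le)
  then have "walk_hitting_time S A \<omega> = ereal (real k)"
    unfolding walk_hitting_time_def
    by (intro antisym INF_greatest INF_lower2[of k]) (auto simp: k)
  with True show ?thesis by (simp add: exp_neg_def k_def)
next
  case False
  then have "{t. S t \<omega> \<in> A} = {}" by auto
  then have "walk_hitting_time S A \<omega> = \<infinity>" by (simp add: walk_hitting_time_def top_ereal_def)
  with False assms show ?thesis by (simp add: exp_neg_def)
qed

text \<open>
  Only the step law \<open>\<mu>\<close> enters the estimates below. Naming it separately from the probability
  space lets them be applied to a whole family of walks at once.
\<close>

locale walk_with_law = prob_space M for M :: "'a measure" +
  fixes \<xi> :: "nat \<Rightarrow> 'a \<Rightarrow> real" and \<mu> :: "real measure"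
  assumes indep: "indep_vars (\<lambda>_. borel) \<xi> {1..}"
    and law: "\<And>i. i \<ge> 1 \<Longrightarrow> distr M borel (\<xi> i) = \<mu>"
begin

lemma steps_measurable: "i \<ge> 1 \<Longrightarrow> \<xi> i \<in> borel_measurable M"
  using indep by (auto simp: indep_vars_def)

lemma walk_measurable [measurable]: "random_walk \<xi> t \<in> borel_measurable M"
proof -
  have "(\<lambda>\<omega>. \<Sum>s=1..t. \<xi> s \<omega>) \<in> borel_measurable M"
    by (intro borel_measurable_sum steps_measurable) auto
  then show ?thesis by (simp add: random_walk_def[abs_def])
qed

lemma sets_law [measurable_cong]: "sets \<mu> = sets borel" and prob_space_law: "prob_space \<mu>"
  using law[of 1, symmetric] steps_measurable[of 1] by (auto intro!: prob_space_distr)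

text \<open>
  The Markov property: given the path up to time \<open>t\<close>, the next step
  can be integrated out against \<open>\<mu>\<close>. The past is regarded as one random vector, independent of
  \<open>\<xi>\<^sub>t\<^sub>+\<^sub>1\<close>, and Fubini's theorem is applied to the product of the two laws.
\<close>

lemma expectation_next_step:
  fixes f :: "real \<Rightarrow> real \<Rightarrow> real"
  assumes f[measurable]: "case_prod f \<in> borel_measurable (borel \<Otimes>\<^sub>M borel)"
    and bounded: "\<And>x y. \<bar>f x y\<bar> \<le> C"
    and D[measurable]: "D \<in> sets borel"
  shows "(\<integral>\<omega>. (if \<forall>s\<le>t. random_walk \<xi> s \<omega> \<in> D then f (random_walk \<xi> t \<omega>) (\<xi> (Suc t) \<omega>) else 0) \<partial>M)
       = (\<integral>\<omega>. (if \<forall>s\<le>t. random_walk \<xi> s \<omega> \<in> D then \<integral>y. f (random_walk \<xi> t \<omega>) y \<partial>\<mu> else 0) \<partial>M)"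
proof -
  define PA where "PA = (PiM {1..t} (\<lambda>_. borel) :: (nat \<Rightarrow> real) measure)"
  define PB where "PB = (PiM {Suc t} (\<lambda>_. borel) :: (nat \<Rightarrow> real) measure)"
  define X where "X \<omega> = restrict (\<lambda>i. \<xi> i \<omega>) {1..t}" for \<omega>
  define Y where "Y = \<xi> (Suc t)"
  define Y where "Y \<omega> = restrict (\<lambda>i. \<xi> i \<omega>) {Suc t}" for \<omega>
  have "indep_var PA X PB Y"
    unfolding PA_def PB_def X_def Y_def by (rule indep_var_restrict[OF indep]) auto
  then have X[measurable]: "X \<in> measurable M PA" and Y[measurable]: "Y \<in> measurable M PB"
    and eq: "distr M PA X \<Otimes>\<^sub>M distr M PB Y = distr M (PA \<Otimes>\<^sub>M PB) (\<lambda>\<omega>. (X \<omega>, Y \<omega>))"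
    by (auto simp: indep_var_distribution_eq)
  have Yv: "Y \<omega> (Suc t) = \<xi> (Suc t) \<omega>" for \<omega> by (simp add: Y_def)
  have coord[measurable]: "(\<lambda>y. y (Suc t)) \<in> borel_measurable PB"
    unfolding PB_def by (rule measurable_component_singleton) simp
  have step[measurable]: "\<xi> (Suc t) \<in> borel_measurable M" by (rule steps_measurable) simp
  define R where "R s x = (\<Sum>i=1..s. x i)" for s and x :: "nat \<Rightarrow> real"
  have R[measurable]: "R s \<in> borel_measurable PA" if "s \<le> t" for s
    unfolding R_def PA_def using that
    by (intro borel_measurable_sum measurable_component_singleton) auto
  have RX: "R s (X \<omega>) = random_walk \<xi> s \<omega>" if "s \<le> t" for s \<omega>
    unfolding R_def X_def random_walk_def using that by (intro sum.cong) auto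
  define h where "h x y = (if \<forall>s\<le>t. R s x \<in> D then f (R t x) y else 0)" for x y
  have [measurable]: "Measurable.pred PA (\<lambda>x. \<forall>s\<le>t. R s x \<in> D)"
  proof -
    have "Measurable.pred PA (\<lambda>x. \<forall>s\<in>{..t}. R s x \<in> D)"
      by (intro pred_intros_finite pred_sets2[OF D]) auto
    then show ?thesis by (simp add: Ball_def)
  qed
  have Rt[measurable]: "R t \<in> borel_measurable PA" by (rule R) simp
  have h[measurable]: "(\<lambda>(x, y). h x y) \<in> borel_measurable (PA \<Otimes>\<^sub>M borel)"
    unfolding h_def by measurable
  interpret PX: prob_space "distr M PA X" by (rule prob_space_distr) simp
  interpret PY: prob_space "distr M PB Y" by (rule prob_space_distr) simp
  interpret P: pair_prob_space "distr M PA X" "distr M PB Y" ..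
  have hb: "\<bar>h x y\<bar> \<le> C" for x y
    using bounded[of 0 0] bounded by (auto simp: h_def intro: order_trans[OF abs_ge_zero])
  have hY[measurable]: "(\<lambda>(x, y). h x (y (Suc t))) \<in> borel_measurable (PA \<Otimes>\<^sub>M PB)"
    by measurable
  have "(\<integral>\<omega>. h (X \<omega>) (\<xi> (Suc t) \<omega>) \<partial>M)
      = (\<integral>z. (case z of (x, y) \<Rightarrow> h x (y (Suc t))) \<partial>distr M (PA \<Otimes>\<^sub>M PB) (\<lambda>\<omega>. (X \<omega>, Y \<omega>)))"
    by (subst integral_distr) (auto simp: Yv)
  also have "\<dots> = (\<integral>z. (case z of (x, y) \<Rightarrow> h x (y (Suc t))) \<partial>(distr M PA X \<Otimes>\<^sub>M distr M PB Y))"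
    by (simp add: eq)
  also have "\<dots> = (\<integral>x. (\<integral>y. h x (y (Suc t)) \<partial>distr M PB Y) \<partial>distr M PA X)"
  proof (rule P.integral_fst'[symmetric, of "\<lambda>(x,y). h x (y (Suc t))", simplified])
    show "integrable (distr M PA X \<Otimes>\<^sub>M distr M PB Y) (\<lambda>(x, y). h x (y (Suc t)))"
      using hb by (intro P.integrable_const_bound[of _ C]) auto
  qed
  also have "\<dots> = (\<integral>x. (\<integral>y. h x y \<partial>\<mu>) \<partial>distr M PA X)"
  proof (rule Bochner_Integration.integral_cong[OF refl])
    fix x assume "x \<in> space (distr M PA X)"
    then have x: "x \<in> space PA" by simp
    have hx: "h x \<in> borel_measurable borel"
      using measurable_compose_Pair1[OF x h] by simp
    have "(\<integral>y. h x (y (Suc t)) \<partial>distr M PB Y) = (\<integral>\<omega>. h x (\<xi> (Suc t) \<omega>) \<partial>M)"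
      by (subst integral_distr) (auto simp: Yv intro!: measurable_compose[OF coord hx])
    also have "\<dots> = (\<integral>y. h x y \<partial>distr M borel (\<xi> (Suc t)))"
      by (subst integral_distr) (auto simp: hx)
    also have "\<dots> = (\<integral>y. h x y \<partial>\<mu>)" by (simp add: law)
    finally show "(\<integral>y. h x (y (Suc t)) \<partial>distr M PB Y) = (\<integral>y. h x y \<partial>\<mu>)" .
  qed
  also have "\<dots> = (\<integral>\<omega>. (\<integral>y. h (X \<omega>) y \<partial>\<mu>) \<partial>M)"
  proof (rule integral_distr)
    interpret mu: prob_space \<mu> by (rule prob_space_law)
    have "(\<lambda>(x, y). h x y) \<in> borel_measurable (PA \<Otimes>\<^sub>M \<mu>)"
      using h by (subst measurable_cong_sets[OF sets_pair_measure_cong[OF refl sets_law] refl])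
    then show "(\<lambda>x. \<integral>y. h x y \<partial>\<mu>) \<in> borel_measurable PA"
      by (rule mu.borel_measurable_lebesgue_integral)
  qed simp
  finally have "(\<integral>\<omega>. h (X \<omega>) (\<xi> (Suc t) \<omega>) \<partial>M) = (\<integral>\<omega>. (\<integral>y. h (X \<omega>) y \<partial>\<mu>) \<partial>M)" .
  moreover have "(\<forall>s\<le>t. R s (X \<omega>) \<in> D) \<longleftrightarrow> (\<forall>s\<le>t. random_walk \<xi> s \<omega> \<in> D)" for \<omega>
    by (simp add: RX)
  then have "h (X \<omega>) y = (if \<forall>s\<le>t. random_walk \<xi> s \<omega> \<in> D then f (random_walk \<xi> t \<omega>) y else 0)" for \<omega> y
    by (simp add: h_def RX cong: if_cong)
  moreover have "(\<integral>y. (if Q then f z y else 0) \<partial>\<mu>) = (if Q then \<integral>y. f z y \<partial>\<mu> else 0)" for Q z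
    by simp
  ultimately show ?thesis
    by simp
qed

end

section \<open>Discounted optional stopping\<close>

text \<open>
  On a path that never leaves \<open>D\<close> the value is \<open>0\<close>, the limit of \<open>e\<^sup>-\<^sup>l\<^sup>t v(s\<^sub>t)\<close> for bounded \<open>v\<close>.
  For \<open>v = 1\<close> this is \<open>e\<^sup>-\<^sup>l\<^sup>\<tau>\<close> with the convention \<open>e\<^sup>-\<^sup>\<infinity> = 0\<close>.
\<close>

definition exit_value :: "real \<Rightarrow> real set \<Rightarrow> (real \<Rightarrow> real) \<Rightarrow> (nat \<Rightarrow> real) \<Rightarrow> real" where
  "exit_value l D v s = (if \<exists>t. s t \<notin> D
     then exp (- l * real (LEAST t. s t \<notin> D)) * v (s (LEAST t. s t \<notin> D)) else 0)"

text \<open>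
  The increment at time \<open>k\<close> of the sequence \<open>e\<^sup>-\<^sup>l\<^sup>t v(s\<^sub>t)\<close> stopped at the exit time \<open>\<tau>\<close>. Written in this way it
  involves only the path up to time \<open>k + 1\<close>, so its measurability and expectation are accessible
  without mentioning \<open>\<tau>\<close>.
\<close>

definition discounted_increment :: "real \<Rightarrow> real set \<Rightarrow> (real \<Rightarrow> real) \<Rightarrow> (nat \<Rightarrow> real) \<Rightarrow> nat \<Rightarrow> real" where
  "discounted_increment l D v s k =
     (if \<forall>i\<le>k. s i \<in> D then exp (- l * real k) * (exp (- l) * v (s (Suc k)) - v (s k)) else 0)"

lemma exp_neg_walk_hitting_time_eq_exit_value:
  "l > 0 \<Longrightarrow> exp_neg (ereal l * walk_hitting_time S (- D) \<omega>) = exit_value l D (\<lambda>_. 1) (\<lambda>t. S t \<omega>)"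
  by (simp add: exp_neg_walk_hitting_time exit_value_def)

text \<open>
  The increments telescope up to the exit time and vanish afterwards.
\<close>

lemma exit_value_limit:
  fixes s :: "nat \<Rightarrow> real"
  assumes l: "l > 0" and v: "\<And>x. \<bar>v x\<bar> \<le> C"
  shows "(\<lambda>n. v (s 0) + (\<Sum>k<n. discounted_increment l D v s k)) \<longlonglongrightarrow> exit_value l D v s"
proof -
  define Z where "Z n = v (s 0) + (\<Sum>k<n. discounted_increment l D v s k)" for n
  have telescope: "Z n = exp (- l * real n) * v (s n)" if "\<forall>i<n. s i \<in> D" for n
    using that
  proof (induction n)
    case (Suc n)
    then have "\<forall>i\<le>n. s i \<in> D" by auto
    moreover have "exp (- l * real (Suc n)) = exp (- l * real n) * exp (- l)"
      by (simp add: algebra_simps exp_add[symmetric])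
    ultimately show ?case
      using Suc by (simp add: Z_def discounted_increment_def algebra_simps)
  qed (simp add: Z_def)
  have "Z \<longlonglongrightarrow> exit_value l D v s"
  proof (cases "\<exists>t. s t \<notin> D")
    case True
    define K where "K = (LEAST t. s t \<notin> D)"
    have K: "s K \<notin> D" unfolding K_def using True by (rule LeastI_ex)
    have "\<forall>i<K. s i \<in> D" unfolding K_def using not_less_Least by blast
    note ZK = telescope[OF this]
    have "Z n = Z K" if "n \<ge> K" for n
      using that
    proof (induction n rule: dec_induct)
      case (step n)
      have "discounted_increment l D v s n = 0"
        using step.hyps K by (auto simp: discounted_increment_def)
      with step.IH show ?case by (simp add: Z_def)
    qed simp
    then have "eventually (\<lambda>n. Z n = exit_value l D v s) sequentially"
      unfolding eventually_sequentially using True ZK by (auto simp: exit_value_def K_def[symmetric])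
    then show ?thesis by (rule tendsto_eventually)
  next
    case False
    have "(\<lambda>n. C * exp (- l) ^ n) \<longlonglongrightarrow> C * 0"
      using l by (intro tendsto_mult tendsto_const LIMSEQ_realpow_zero) auto
    then have "(\<lambda>n. C * exp (- l * real n)) \<longlonglongrightarrow> 0"
      by (simp add: exp_of_nat_mult[symmetric] mult.commute)
    then have "Z \<longlonglongrightarrow> 0"
    proof (rule Lim_null_comparison[rotated])
      show "eventually (\<lambda>n. norm (Z n) \<le> C * exp (- l * real n)) sequentially"
        using False telescope v by (intro always_eventually allI) (simp add: abs_mult)
    qed
    with False show ?thesis by (simp add: exit_value_def)
  qed
  then show ?thesis by (simp add: Z_def[abs_def])
qed

lemma discounted_increment_bound:
  assumes v: "\<And>x. \<bar>v x\<bar> \<le> C" and l: "l > 0"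
  shows "\<bar>discounted_increment l D v s k\<bar> \<le> 2 * C * exp (- l) ^ k"
proof -
  have C: "0 \<le> C" using v[of 0] by linarith
  have "\<bar>exp (- l) * v (s (Suc k)) - v (s k)\<bar> \<le> exp (- l) * \<bar>v (s (Suc k))\<bar> + \<bar>v (s k)\<bar>"
    by (metis abs_exp_cancel abs_mult abs_triangle_ineq4)
  also have "\<dots> \<le> 1 * C + C"
    using l C by (intro add_mono mult_mono v) auto
  finally have "\<bar>exp (- l) * v (s (Suc k)) - v (s k)\<bar> \<le> 2 * C" by simp
  moreover have "exp (- l * real k) = exp (- l) ^ k"
    by (simp add: exp_of_nat_mult[symmetric] mult.commute)
  ultimately show ?thesis
    using C by (auto simp: discounted_increment_def abs_mult mult.commute intro: mult_right_mono)
qed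

lemma geometric_partial_sum_bound:
  assumes "l > 0" "c \<ge> 0"
  shows "(\<Sum>k<n. c * exp (- l) ^ k) \<le> c / (1 - exp (- l :: real))"
proof -
  have "(\<Sum>k<n. c * exp (- l) ^ k) \<le> (\<Sum>k. c * exp (- l) ^ k)"
    using assms by (intro sum_le_suminf summable_mult summable_geometric) auto
  also have "\<dots> = c / (1 - exp (- l))"
    using assms by (subst suminf_mult) (auto simp: suminf_geometric summable_geometric divide_simps)
  finally show ?thesis .
qed

context walk_with_law
begin

lemma exit_value_measurable:
  assumes [measurable]: "v \<in> borel_measurable borel" "D \<in> sets borel"
    and v: "\<And>x. \<bar>v x\<bar> \<le> C" and l: "l > 0"
  shows "(\<lambda>\<omega>. exit_value l D v (\<lambda>t. random_walk \<xi> t \<omega>)) \<in> borel_measurable M"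
    (is "?f \<in> _")
proof (rule borel_measurable_LIMSEQ_real)
  fix \<omega>
  show "(\<lambda>n. v (random_walk \<xi> 0 \<omega>) + (\<Sum>k<n. discounted_increment l D v (\<lambda>t. random_walk \<xi> t \<omega>) k)) \<longlonglongrightarrow> ?f \<omega>"
    using exit_value_limit[OF l v, of _ "\<lambda>t. random_walk \<xi> t \<omega>"] by simp
next
  fix n
  have [measurable]: "Measurable.pred M (\<lambda>\<omega>. \<forall>i\<le>k. random_walk \<xi> i \<omega> \<in> D)" for k
  proof -
    have "Measurable.pred M (\<lambda>\<omega>. \<forall>i\<in>{..k}. random_walk \<xi> i \<omega> \<in> D)"
      by (intro pred_intros_finite pred_sets2[OF assms(2)]) auto
    then show ?thesis by (simp add: Ball_def)
  qed
  show "(\<lambda>\<omega>. v (random_walk \<xi> 0 \<omega>) + (\<Sum>k<n. discounted_increment l D v (\<lambda>t. random_walk \<xi> t \<omega>) k))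
      \<in> borel_measurable M"
    unfolding discounted_increment_def by measurable
qed

text \<open>
  Discounting makes the drift errors summable: \<open>\<Sum>\<^sub>t \<delta> e\<^sup>-\<^sup>l\<^sup>t = \<delta> / (1 - e\<^sup>-\<^sup>l)\<close>. It also makes the
  stopped process converge boundedly to \<open>exit_value\<close>, even where \<open>\<tau> = \<infinity>\<close>.
\<close>

theorem expectation_discounted_hit:
  assumes v_meas[measurable]: "v \<in> borel_measurable borel" and D[measurable]: "D \<in> sets borel"
    and v: "\<And>x. \<bar>v x\<bar> \<le> C" and l: "l > 0"
    and step: "\<And>x. x \<in> D \<Longrightarrow> \<bar>exp (- l) * (\<integral>y. v (x + y) \<partial>\<mu>) - v x\<bar> \<le> \<delta>"
    and exit: "\<And>x. x \<notin> D \<Longrightarrow> \<bar>v x - 1\<bar> \<le> \<epsilon>" and \<delta>: "0 \<le> \<delta>" and \<epsilon>: "0 \<le> \<epsilon>"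
  shows "\<bar>(\<integral>\<omega>. exp_neg (ereal l * walk_hitting_time (random_walk \<xi>) (- D) \<omega>) \<partial>M) - v 0\<bar>
    \<le> \<delta> / (1 - exp (- l)) + \<epsilon>"
proof -
  let ?s = "\<lambda>\<omega> t. random_walk \<xi> t \<omega>"
  interpret mu: prob_space \<mu> by (rule prob_space_law)
  have C: "0 \<le> C" using v[of 0] by linarith
  define d where "d k = (\<lambda>\<omega>. discounted_increment l D v (?s \<omega>) k)" for k
  define Z where "Z n \<omega> = v 0 + (\<Sum>k<n. d k \<omega>)" for n \<omega>
  have pred[measurable]: "Measurable.pred M (\<lambda>\<omega>. \<forall>i\<le>k. random_walk \<xi> i \<omega> \<in> D)" for k
  proof -
    have "Measurable.pred M (\<lambda>\<omega>. \<forall>i\<in>{..k}. random_walk \<xi> i \<omega> \<in> D)"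
      by (intro pred_intros_finite pred_sets2[OF D]) auto
    then show ?thesis by (simp add: Ball_def)
  qed
  have d_meas[measurable]: "d k \<in> borel_measurable M" for k
    unfolding d_def discounted_increment_def by measurable
  have d_bound: "\<bar>d k \<omega>\<bar> \<le> 2 * C * exp (- l) ^ k" for k \<omega>
    unfolding d_def by (rule discounted_increment_bound[OF v l])
  have d_int: "integrable M (d k)" for k
    by (rule integrable_const_bound[where B="2 * C * exp (- l) ^ k"]) (auto simp: d_bound)
  have Z_meas[measurable]: "Z n \<in> borel_measurable M" for n
    unfolding Z_def[abs_def] by measurable
  have Ed: "\<bar>expectation (d k)\<bar> \<le> \<delta> * exp (- l) ^ k" for k
  proof -
    define f where "f x y = exp (- l * real k) * (exp (- l) * v (x + y) - v x)" for x y
    have f_bound: "\<bar>f x y\<bar> \<le> 1 * (2 * C)" for x y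
    proof -
      have "\<bar>exp (- l) * v (x + y) - v x\<bar> \<le> exp (- l) * \<bar>v (x + y)\<bar> + \<bar>v x\<bar>"
        by (metis abs_exp_cancel abs_mult abs_triangle_ineq4)
      also have "\<dots> \<le> 1 * C + C"
        using l C by (intro add_mono mult_mono v) auto
      finally show ?thesis
        unfolding f_def abs_mult using l C by (intro mult_mono) auto
    qed
    have inner: "(\<integral>y. f x y \<partial>\<mu>) = exp (- l) ^ k * (exp (- l) * (\<integral>y. v (x + y) \<partial>\<mu>) - v x)" for x
    proof -
      have "integrable \<mu> (\<lambda>y. v (x + y))"
        by (rule mu.integrable_const_bound[where B=C]) (auto simp: v)
      then show ?thesis
        by (simp add: f_def exp_of_nat_mult[symmetric] mult.commute mu.prob_space)
    qed
    have "expectation (d k)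
        = (\<integral>\<omega>. (if \<forall>s\<le>k. ?s \<omega> s \<in> D then f (?s \<omega> k) (\<xi> (Suc k) \<omega>) else 0) \<partial>M)"
      by (simp add: d_def discounted_increment_def f_def cong: if_cong)
    also have "\<dots> = (\<integral>\<omega>. (if \<forall>s\<le>k. ?s \<omega> s \<in> D then \<integral>y. f (?s \<omega> k) y \<partial>\<mu> else 0) \<partial>M)"
      by (rule expectation_next_step[OF _ f_bound D]) (simp add: f_def)
    also have "\<bar>\<dots>\<bar> \<le> (\<integral>\<omega>. \<delta> * exp (- l) ^ k \<partial>M)"
    proof -
      have le: "\<bar>if \<forall>s\<le>k. ?s \<omega> s \<in> D then \<integral>y. f (?s \<omega> k) y \<partial>\<mu> else 0\<bar> \<le> \<delta> * exp (- l) ^ k" for \<omega>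
      proof (cases "\<forall>s\<le>k. ?s \<omega> s \<in> D")
        case True
        then have "?s \<omega> k \<in> D" by auto
        from step[OF this] True show ?thesis
          by (simp add: inner abs_mult mult.commute[of \<delta>] mult_left_mono)
      next
        case False
        show ?thesis unfolding if_not_P[OF False] using \<delta> by simp
      qed
      show ?thesis
        unfolding real_norm_def[symmetric]
        by (rule order_trans[OF integral_norm_bound integral_mono'])
           (use le \<delta> in \<open>auto simp: mult_nonneg_nonneg\<close>)
    qed
    finally show ?thesis by (simp add: prob_space)
  qed
  have EZ: "\<bar>expectation (Z n) - v 0\<bar> \<le> \<delta> / (1 - exp (- l))" for n
  proof -
    have "expectation (Z n) - v 0 = (\<Sum>k<n. expectation (d k))"
      unfolding Z_def using d_int by (simp add: prob_space)
    also have "\<bar>\<dots>\<bar> \<le> (\<Sum>k<n. \<delta> * exp (- l) ^ k)"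
      by (rule order_trans[OF sum_abs sum_mono]) (rule Ed)
    also have "\<dots> \<le> \<delta> / (1 - exp (- l))"
      by (rule geometric_partial_sum_bound[OF l \<delta>])
    finally show ?thesis .
  qed
  define V where "V \<omega> = exit_value l D v (?s \<omega>)" for \<omega>
  define H where "H \<omega> = exit_value l D (\<lambda>_. 1) (?s \<omega>)" for \<omega>
  have V[measurable]: "V \<in> borel_measurable M"
    unfolding V_def[abs_def] by (rule exit_value_measurable[OF v_meas D v l])
  have H[measurable]: "H \<in> borel_measurable M"
    unfolding H_def[abs_def] by (rule exit_value_measurable[OF _ D _ l, where C=1]) auto
  have "(\<lambda>n. expectation (Z n)) \<longlonglongrightarrow> expectation V"
  proof (rule integral_dominated_convergence[where w="\<lambda>_. C + 2 * C / (1 - exp (- l))"])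
    show "AE \<omega> in M. (\<lambda>n. Z n \<omega>) \<longlonglongrightarrow> V \<omega>"
    proof (rule AE_I2)
      fix \<omega>
      show "(\<lambda>n. Z n \<omega>) \<longlonglongrightarrow> V \<omega>"
        using exit_value_limit[OF l v, where s="?s \<omega>"] by (simp add: Z_def V_def d_def)
    qed
    show "AE \<omega> in M. norm (Z n \<omega>) \<le> C + 2 * C / (1 - exp (- l))" for n
    proof (rule AE_I2)
      fix \<omega>
      have "\<bar>\<Sum>k<n. d k \<omega>\<bar> \<le> (\<Sum>k<n. 2 * C * exp (- l) ^ k)"
        by (rule order_trans[OF sum_abs sum_mono]) (rule d_bound)
      also have "\<dots> \<le> 2 * C / (1 - exp (- l))"
        using C by (intro geometric_partial_sum_bound[OF l]) auto
      finally show "norm (Z n \<omega>) \<le> C + 2 * C / (1 - exp (- l))"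
        using v[of 0] by (simp add: Z_def)
    qed
  qed simp_all
  then have "(\<lambda>n. \<bar>expectation (Z n) - v 0\<bar>) \<longlonglongrightarrow> \<bar>expectation V - v 0\<bar>"
    by (intro tendsto_intros)
  then have EV: "\<bar>expectation V - v 0\<bar> \<le> \<delta> / (1 - exp (- l))"
    by (rule LIMSEQ_le_const2) (use EZ in auto)
  have VH: "\<bar>V \<omega> - H \<omega>\<bar> \<le> \<epsilon>" and Hb: "\<bar>H \<omega>\<bar> \<le> 1" for \<omega>
  proof -
    have e: "exp (- l * real k) \<le> 1" for k using l by simp
    show "\<bar>H \<omega>\<bar> \<le> 1" using e by (auto simp: H_def exit_value_def)
    show "\<bar>V \<omega> - H \<omega>\<bar> \<le> \<epsilon>"
    proof (cases "\<exists>t. ?s \<omega> t \<notin> D")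
      case True
      define K where "K = (LEAST t. ?s \<omega> t \<notin> D)"
      have "?s \<omega> K \<notin> D" unfolding K_def using True by (rule LeastI_ex)
      note exit[OF this]
      moreover have "V \<omega> - H \<omega> = exp (- l * real K) * (v (?s \<omega> K) - 1)"
        using True by (simp add: V_def H_def exit_value_def K_def algebra_simps)
      ultimately show ?thesis
        using e[of K] mult_mono[of "exp (- l * real K)" 1 "\<bar>v (?s \<omega> K) - 1\<bar>" \<epsilon>]
        by (simp add: abs_mult)
    qed (use \<epsilon> in \<open>simp add: V_def H_def exit_value_def\<close>)
  qed
  have iH: "integrable M H"
    by (rule integrable_const_bound[where B=1]) (auto simp: Hb)
  have iV: "integrable M V"
  proof (rule integrable_const_bound[where B="1 + \<epsilon>"])
    have "\<bar>V \<omega>\<bar> \<le> 1 + \<epsilon>" for \<omega> using VH[of \<omega>] Hb[of \<omega>] by linarith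
    then show "AE \<omega> in M. norm (V \<omega>) \<le> 1 + \<epsilon>" by simp
  qed simp
  have "\<bar>expectation V - expectation H\<bar> = \<bar>\<integral>\<omega>. V \<omega> - H \<omega> \<partial>M\<bar>"
    using iH iV by simp
  also have "\<dots> \<le> (\<integral>\<omega>. \<epsilon> \<partial>M)"
    unfolding real_norm_def[symmetric]
    by (rule order_trans[OF integral_norm_bound integral_mono']) (use VH \<epsilon> in auto)
  finally have "\<bar>expectation V - expectation H\<bar> \<le> \<epsilon>" by (simp add: prob_space)
  with EV have "\<bar>expectation H - v 0\<bar> \<le> \<delta> / (1 - exp (- l)) + \<epsilon>" by linarith
  then show ?thesis
    by (simp add: H_def[abs_def] exp_neg_walk_hitting_time_eq_exit_value[OF l])
qed

end

section \<open>The scaling limit for exit times of half-lines and intervals\<close>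

lemma scaled_hitting_time:
  assumes "c > 0"
  shows "ereal \<theta> * t / ereal c = ereal (\<theta> / c) * t"
  using assms by (cases t) (auto simp: divide_ereal_def field_simps zero_less_mult_iff)

text \<open>
  With \<open>l = \<theta> / b\<^sup>2\<close> this turns a one-step error \<open>\<delta>\<close> into a total error
  \<open>\<delta> / (1 - e\<^sup>-\<^sup>l)\<close> of order \<open>b\<^sup>2 \<delta>\<close>.
\<close>

lemma one_minus_exp_neg_ge:
  fixes l :: real
  assumes "0 \<le> l" "l \<le> 1"
  shows "l / 2 \<le> 1 - exp (- l)"
proof -
  have "(1 - l / 2) * (1 + l) = 1 + l / 2 * (1 - l)" by (simp add: field_simps)
  then have "1 \<le> (1 - l / 2) * (1 + l)" using assms by simp
  also have "\<dots> \<le> (1 - l / 2) * exp l"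
    using assms by (intro mult_left_mono exp_ge_add_one_self) auto
  finally have "exp (- l) \<le> (1 - l / 2) * exp l * exp (- l)" by (simp add: exp_minus field_simps)
  then show ?thesis by (simp add: exp_minus field_simps)
qed

text \<open>
  This controls overshoots: by Chebyshev's argument a single step exceeds \<open>\<epsilon> b\<close> with probability
  \<open>o(b\<^sup>-\<^sup>2)\<close>, so that the order \<open>b\<^sup>2\<close> of steps that matter contains such a step with vanishing
  probability.
\<close>

lemma truncated_second_moment_tendsto_0:
  fixes \<mu> :: "real measure"
  assumes sets[measurable_cong]: "sets \<mu> = sets borel"
    and "integrable \<mu> (\<lambda>x. x\<^sup>2)" and \<epsilon>: "\<epsilon> > 0"
  shows "((\<lambda>b. \<integral>y. y\<^sup>2 * indicator {y. \<bar>y\<bar> > \<epsilon> * b} y \<partial>\<mu>) \<longlongrightarrow> 0) at_top"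
proof -
  have "((\<lambda>b. \<integral>y. y\<^sup>2 * indicator {y. \<bar>y\<bar> > \<epsilon> * b} y \<partial>\<mu>) \<longlongrightarrow> (\<integral>y. 0 \<partial>\<mu>)) at_top"
  proof (rule integral_dominated_convergence_at_top[where w="\<lambda>x. x\<^sup>2"])
    show "AE y in \<mu>. ((\<lambda>b. y\<^sup>2 * indicator {y. \<bar>y\<bar> > \<epsilon> * b} y) \<longlongrightarrow> 0) at_top"
    proof (rule AE_I2, rule tendsto_eventually)
      fix y
      show "\<forall>\<^sub>F b in at_top. y\<^sup>2 * indicator {y. \<bar>y\<bar> > \<epsilon> * b} y = 0"
        using eventually_ge_at_top[of "\<bar>y\<bar> / \<epsilon>"]
        by eventually_elim (use \<epsilon> in \<open>auto simp: field_simps\<close>)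
    qed
  qed (use assms in \<open>auto simp: indicator_def intro!: always_eventually\<close>)
  then show ?thesis by simp
qed

text \<open>
  The function \<open>p\<close> measures the position in units of the level, so that one proof covers \<open>p(x) = |x|\<close>
  and \<open>p(x) = x\<close>. The Taylor hypothesis encodes \<open>g'' = 2 \<theta> g\<close> with a bounded third derivative: after
  integration the linear term disappears, the quadratic one contributes \<open>\<theta> g / b\<^sup>2\<close>, and this is
  balanced by \<open>e\<^sup>-\<^sup>l \<approx> 1 - \<theta> / b\<^sup>2\<close>. The walks may vary with the index because the error bound involves
  their common law only; this freedom is what makes the result applicable to Brownian motion.
\<close>

theorem hitting_transform_limit:
  fixes \<mu> :: "real measure" and p g g' :: "real \<Rightarrow> real" and M :: "'i \<Rightarrow> 'a measure"
  assumes prob: "prob_space \<mu>" and sets[measurable_cong]: "sets \<mu> = sets borel"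
    and mean: "has_bochner_integral \<mu> (\<lambda>x. x) 0" and var: "has_bochner_integral \<mu> (\<lambda>x. x\<^sup>2) 1"
    and \<theta>: "\<theta> > 0"
    and p[measurable]: "p \<in> borel_measurable borel"
    and p_add: "\<And>x y. p (x + y) \<le> p x + \<bar>y\<bar>"
    and p_scale: "\<And>c x. c \<ge> 0 \<Longrightarrow> p (c * x) = c * p x"
    and g[measurable]: "g \<in> borel_measurable borel"
    and taylor: "\<And>x y. p x < 1 \<Longrightarrow> \<bar>y\<bar> \<le> 1 \<Longrightarrow>
          \<bar>g (x + y) - g x - g' x * y - \<theta> * g x * y\<^sup>2\<bar> \<le> K * \<bar>y\<bar> ^ 3"
    and g_bound: "\<And>x. p x < 2 \<Longrightarrow> \<bar>g x\<bar> \<le> K"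
    and g'_bound: "\<And>x. p x < 1 \<Longrightarrow> \<bar>g' x\<bar> \<le> K"
    and boundary: "\<And>x. 1 \<le> p x \<Longrightarrow> p x < 2 \<Longrightarrow> \<bar>g x - 1\<bar> \<le> K * (p x - 1)"
    and walks: "\<And>i. walk_with_law (M i) (\<xi> i) \<mu>" and b_at_top: "filterlim b at_top F"
  shows "((\<lambda>i. \<integral>\<omega>. exp_neg (ereal \<theta> * walk_hitting_time (random_walk (\<xi> i)) {x. b i \<le> p x} \<omega> / ereal ((b i)\<^sup>2)) \<partial>M i)
    \<longlongrightarrow> g 0) F"
proof (rule tendstoI)
  fix \<eta>' :: real
  assume "\<eta>' > 0"
  define \<eta> where "\<eta> = \<eta>' / 2"
  have \<eta>: "\<eta> > 0" "\<eta> < \<eta>'" using \<open>\<eta>' > 0\<close> by (auto simp: \<eta>_def)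
  interpret mu: prob_space \<mu> by (rule prob)
  have p0: "p 0 = 0" using p_scale[of 0 0] by simp
  have K: "0 \<le> K" using g_bound[of 0] p0 by simp
  define A where "A = K * (2 / \<theta> + 1)"
  have A: "0 \<le> A" using K \<theta> by (simp add: A_def)
  \<comment> \<open>\<open>A \<epsilon>\<close> collects the errors that do not vanish as \<open>b \<rightarrow> \<infinity>\<close>: the cubic Taylor term, summed over
    time, and the deviation of \<open>g\<close> from \<open>1\<close> within distance \<open>\<epsilon>\<close> of the boundary.\<close>
  define \<epsilon> where "\<epsilon> = min (1/2) (\<eta> / (2 * (A + 1)))"
  have \<epsilon>: "0 < \<epsilon>" "\<epsilon> < 1" using \<eta> A by (auto simp: \<epsilon>_def)
  have "A * \<epsilon> \<le> A * (\<eta> / (2 * (A + 1)))" using A by (intro mult_left_mono) (auto simp: \<epsilon>_def)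
  also have "\<dots> \<le> \<eta> / 2" using A \<eta> by (simp add: field_simps)
  finally have A\<epsilon>: "A * \<epsilon> \<le> \<eta> / 2" .
  \<comment> \<open>For \<open>|Y| > \<epsilon>\<close> all terms of the Taylor remainder are bounded by multiples of \<open>Y\<^sup>2\<close>, because
    \<open>1 \<le> Y\<^sup>2 / \<epsilon>\<^sup>2\<close> and \<open>|Y| \<le> Y\<^sup>2 / \<epsilon>\<close>.\<close>
  define C where "C = (2 * K + 1) / \<epsilon>\<^sup>2 + K / \<epsilon> + \<theta> * K"
  have C: "0 \<le> C" using K \<epsilon> \<theta> by (simp add: C_def)
  define m where "m b = (\<integral>y. y\<^sup>2 * indicator {y. \<bar>y\<bar> > \<epsilon> * b} y \<partial>\<mu>)" for b
  have int1: "integrable \<mu> (\<lambda>x. x)" "(\<integral>x. x \<partial>\<mu>) = 0"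
    and int2: "integrable \<mu> (\<lambda>x. x\<^sup>2)" "(\<integral>x. x\<^sup>2 \<partial>\<mu>) = 1"
    using mean var by (auto simp: has_bochner_integral_iff)
  have m: "(m \<longlongrightarrow> 0) at_top"
    unfolding m_def[abs_def] by (rule truncated_second_moment_tendsto_0[OF sets int2(1) \<epsilon>(1)])
  have inverse_square: "((\<lambda>b. \<theta> / b\<^sup>2) \<longlongrightarrow> 0) at_top"
    by (intro tendsto_divide_0[OF tendsto_const] filterlim_at_top_imp_at_infinity
        filterlim_pow_at_top filterlim_ident) simp
  have "((\<lambda>b. 2 * C * m b / \<theta> + 2 * K * (\<theta> / b\<^sup>2)) \<longlongrightarrow> 2 * C * 0 / \<theta> + 2 * K * 0) at_top"
    by (intro tendsto_intros m inverse_square) (use \<theta> in auto)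
  then have "eventually (\<lambda>b. 2 * C * m b / \<theta> + 2 * K * (\<theta> / b\<^sup>2) < \<eta> / 2) at_top"
    by (rule order_tendstoD) (use \<eta> in auto)
  moreover have "eventually (\<lambda>b::real. \<theta> / b\<^sup>2 < 1) at_top"
    by (rule order_tendstoD[OF inverse_square]) simp
  moreover have "eventually (\<lambda>b::real. b > 0) at_top" by (rule eventually_gt_at_top)
  ultimately have "eventually (\<lambda>b. 2 * C * m b / \<theta> + 2 * K * (\<theta> / b\<^sup>2) < \<eta> / 2 \<and> \<theta> / b\<^sup>2 \<le> 1 \<and> b > 0) at_top"
    by eventually_elim simp
  then obtain B where B: "\<And>b. b \<ge> B \<Longrightarrow> 2 * C * m b / \<theta> + 2 * K * (\<theta> / b\<^sup>2) < \<eta> / 2 \<and> \<theta> / b\<^sup>2 \<le> 1 \<and> b > 0"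
    by (auto simp: eventually_at_top_linorder)
  have near: "\<bar>(\<integral>\<omega>. exp_neg (ereal \<theta> * walk_hitting_time (random_walk \<xi>) {x. b \<le> p x} \<omega> / ereal (b\<^sup>2)) \<partial>M) - g 0\<bar> \<le> \<eta>"
    if "B \<le> b" and walk: "walk_with_law M \<xi> \<mu>" for b and M :: "'a measure" and \<xi>
  proof -
    from \<open>B \<le> b\<close> have b_small: "2 * C * m b / \<theta> + 2 * K * (\<theta> / b\<^sup>2) < \<eta> / 2" and l1: "\<theta> / b\<^sup>2 \<le> 1" and b: "b > 0"
      using B[of b] by auto
    interpret walk_with_law M \<xi> \<mu> by (rule walk)
    define l where "l = \<theta> / b\<^sup>2"
    have l: "l > 0" "l \<le> 1" using \<theta> b l1 by (auto simp: l_def)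
    \<comment> \<open>The truncation keeps \<open>v\<close> bounded and leaves a margin \<open>\<epsilon>\<close>, so that small steps from the region
    stay where \<open>v = g\<close>.\<close>
    define v where "v x = (if p (x / b) < 1 + \<epsilon> then g (x / b) else 1)" for x
    define D where "D = {x. p x < b}"
    have D[measurable]: "D \<in> sets borel" unfolding D_def by measurable
    have D_iff: "x \<in> D \<longleftrightarrow> p (x / b) < 1" for x
    proof -
      have "p x = b * p (x / b)" using p_scale[of b "x / b"] b by simp
      then show ?thesis using b by (simp add: D_def mult_less_cancel_left2)
    qed
    have v_bound: "\<bar>v x\<bar> \<le> K + 1" for x
      using g_bound[of "x / b"] \<epsilon> K by (auto simp: v_def)
    have v_meas: "v \<in> borel_measurable borel" unfolding v_def by measurable
    have exit: "\<bar>v x - 1\<bar> \<le> K * \<epsilon>" if "x \<notin> D" for x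
    proof (cases "p (x / b) < 1 + \<epsilon>")
      case True
      then have "\<bar>g (x / b) - 1\<bar> \<le> K * (p (x / b) - 1)"
        using that \<epsilon> by (intro boundary) (auto simp: D_iff)
      also have "\<dots> \<le> K * \<epsilon>" using K True by (intro mult_left_mono) auto
      finally show ?thesis using True by (simp add: v_def)
    qed (use K \<epsilon> in \<open>simp add: v_def\<close>)
    define \<delta> where "\<delta> = (K * \<epsilon> + C * m b) / b\<^sup>2 + K * l\<^sup>2"
    have m_nonneg: "0 \<le> m b" unfolding m_def by (rule integral_nonneg_AE) auto
    have step: "\<bar>exp (- l) * (\<integral>y. v (x + y) \<partial>\<mu>) - v x\<bar> \<le> \<delta>" if "x \<in> D" for x
    proof -
      define X where "X = x / b"
      have X: "p X < 1" using that by (simp add: X_def D_iff)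
      have gX: "\<bar>g X\<bar> \<le> K" and vX: "v x = g X" using X g_bound[of X] \<epsilon> by (auto simp: v_def X_def[symmetric])
      define r where "r y = v (x + y) - g X - g' X * (y / b) - \<theta> * g X * (y / b)\<^sup>2" for y
      define w where "w y = K * \<epsilon> / b\<^sup>2 * y\<^sup>2 + C / b\<^sup>2 * (y\<^sup>2 * indicator {y. \<bar>y\<bar> > \<epsilon> * b} y)" for y
      have r_bound: "\<bar>r y\<bar> \<le> w y" for y
      proof -
        define Y where "Y = y / b"
        have XY: "(x + y) / b = X + Y" by (simp add: X_def Y_def add_divide_distrib)
        show ?thesis
        proof (cases "\<bar>y\<bar> > \<epsilon> * b")
          case False
          then have Y: "\<bar>Y\<bar> \<le> \<epsilon>" using b by (simp add: Y_def abs_divide field_simps)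
          have "p (X + Y) < 1 + \<epsilon>" using p_add[of X Y] X Y by linarith
          then have "r y = g (X + Y) - g X - g' X * Y - \<theta> * g X * Y\<^sup>2"
            by (simp add: r_def v_def XY Y_def[symmetric])
          also have "\<bar>\<dots>\<bar> \<le> K * \<bar>Y\<bar> ^ 3" using X Y \<epsilon> by (intro taylor) auto
          also have "\<dots> = K * \<bar>Y\<bar> * Y\<^sup>2" by (simp add: power3_eq_cube power2_eq_square abs_mult_self_eq)
          also have "\<dots> \<le> K * \<epsilon> * Y\<^sup>2" using K Y by (intro mult_right_mono mult_left_mono) auto
          finally show ?thesis using False by (simp add: w_def Y_def power_divide)
        next
          case True
          then have Y: "\<bar>Y\<bar> > \<epsilon>" using b by (simp add: Y_def abs_divide field_simps)
          have "1 \<le> \<bar>Y\<bar> / \<epsilon>" using Y \<epsilon> by simp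
          then have q1: "\<bar>Y\<bar> \<le> Y\<^sup>2 / \<epsilon>" and q2: "1 \<le> Y\<^sup>2 / \<epsilon>\<^sup>2"
            using mult_left_mono[of 1 "\<bar>Y\<bar> / \<epsilon>" "\<bar>Y\<bar>"] power_mono[of 1 "\<bar>Y\<bar> / \<epsilon>" 2]
            by (simp_all add: power2_eq_square power_divide)
          have g'X: "\<bar>g' X\<bar> \<le> K" by (rule g'_bound[OF X])
          have "\<bar>r y\<bar> \<le> \<bar>v (x + y)\<bar> + \<bar>g X\<bar> + \<bar>g' X\<bar> * \<bar>Y\<bar> + \<theta> * \<bar>g X\<bar> * Y\<^sup>2"
            unfolding r_def Y_def[symmetric]
          proof -
            have "\<bar>\<theta> * g X * Y\<^sup>2\<bar> = \<theta> * \<bar>g X\<bar> * Y\<^sup>2" using \<theta> by (simp add: abs_mult)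
            then show "\<bar>v (x + y) - g X - g' X * Y - \<theta> * g X * Y\<^sup>2\<bar>
                \<le> \<bar>v (x + y)\<bar> + \<bar>g X\<bar> + \<bar>g' X\<bar> * \<bar>Y\<bar> + \<theta> * \<bar>g X\<bar> * Y\<^sup>2"
              using abs_mult[of "g' X" Y] by linarith
          qed
          also have "\<dots> \<le> (K + 1) + K + K * (Y\<^sup>2 / \<epsilon>) + \<theta> * K * Y\<^sup>2"
            using q1 K \<theta> gX g'X v_bound by (intro add_mono mult_mono) auto
          also have "\<dots> \<le> (2 * K + 1) * (Y\<^sup>2 / \<epsilon>\<^sup>2) + K * (Y\<^sup>2 / \<epsilon>) + \<theta> * K * Y\<^sup>2"
            using mult_left_mono[OF q2, of "2 * K + 1"] K by simp
          also have "\<dots> = C * Y\<^sup>2" by (simp add: C_def field_simps)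
          also have "\<dots> \<le> w y" using True K \<epsilon> by (simp add: w_def Y_def power_divide)
          finally show ?thesis .
        qed
      qed
      have tr_int: "integrable \<mu> (\<lambda>y. y\<^sup>2 * indicator {y. \<bar>y\<bar> > \<epsilon> * b} y)"
        by (rule Bochner_Integration.integrable_bound[OF int2(1)]) (auto simp: indicator_def)
      have w_int: "integrable \<mu> w" and w_val: "(\<integral>y. w y \<partial>\<mu>) = (K * \<epsilon> + C * m b) / b\<^sup>2"
        using int2 tr_int by (auto simp: w_def[abs_def] m_def add_divide_distrib)
      have v_int: "integrable \<mu> (\<lambda>y. v (x + y))"
        by (rule mu.integrable_const_bound[where B="K+1"]) (use v_meas in \<open>auto simp: v_bound\<close>)
      have r_int: "integrable \<mu> r" and r_val: "(\<integral>y. r y \<partial>\<mu>) = (\<integral>y. v (x + y) \<partial>\<mu>) - g X * (1 + l)"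
        using v_int int1 int2
        by (auto simp: r_def[abs_def] power_divide mu.prob_space l_def algebra_simps)
      have "\<bar>\<integral>y. r y \<partial>\<mu>\<bar> \<le> (\<integral>y. w y \<partial>\<mu>)"
        unfolding real_norm_def[symmetric]
        by (rule order_trans[OF integral_norm_bound integral_mono])
           (use r_int w_int r_bound in auto)
      then have E: "\<bar>(\<integral>y. v (x + y) \<partial>\<mu>) - g X * (1 + l)\<bar> \<le> (K * \<epsilon> + C * m b) / b\<^sup>2"
        by (simp add: r_val w_val)
      have q: "\<bar>exp (- l) * (1 + l) - 1\<bar> \<le> l\<^sup>2"
      proof -
        have "exp (- l) * (1 + l) \<le> exp (- l) * exp l"
          by (intro mult_left_mono exp_ge_add_one_self) auto
        moreover have "(1 - l) * (1 + l) \<le> exp (- l) * (1 + l)"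
          using exp_ge_add_one_self[of "- l"] l by (intro mult_right_mono) auto
        ultimately show ?thesis by (simp add: exp_minus power2_eq_square algebra_simps)
      qed
      have "exp (- l) * (\<integral>y. v (x + y) \<partial>\<mu>) - v x
          = exp (- l) * ((\<integral>y. v (x + y) \<partial>\<mu>) - g X * (1 + l)) + g X * (exp (- l) * (1 + l) - 1)"
        by (simp add: vX algebra_simps)
      also have "\<bar>\<dots>\<bar> \<le> exp (- l) * \<bar>(\<integral>y. v (x + y) \<partial>\<mu>) - g X * (1 + l)\<bar> + \<bar>g X\<bar> * \<bar>exp (- l) * (1 + l) - 1\<bar>"
        by (rule order_trans[OF abs_triangle_ineq]) (simp add: abs_mult)
      also have "\<dots> \<le> 1 * ((K * \<epsilon> + C * m b) / b\<^sup>2) + K * l\<^sup>2"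
        using l K gX E q by (intro add_mono mult_mono) auto
      finally show ?thesis by (simp add: \<delta>_def)
    qed
    have \<delta>0: "0 \<le> \<delta>" using K \<epsilon> C m_nonneg by (simp add: \<delta>_def)
    have "\<bar>(\<integral>\<omega>. exp_neg (ereal l * walk_hitting_time (random_walk \<xi>) (- D) \<omega>) \<partial>M) - v 0\<bar>
      \<le> \<delta> / (1 - exp (- l)) + K * \<epsilon>"
      using K \<epsilon> \<delta>0 by (intro expectation_discounted_hit[OF v_meas D v_bound l(1) step exit]) auto
    also have "\<dots> \<le> \<delta> / (l / 2) + K * \<epsilon>"
      using l \<delta>0 one_minus_exp_neg_ge[of l] by (intro add_mono divide_left_mono) auto
    also have "\<delta> / (l / 2) = 2 * K * \<epsilon> / \<theta> + (2 * C * m b / \<theta> + 2 * K * (\<theta> / b\<^sup>2))"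
      using \<theta> b by (simp add: \<delta>_def l_def field_simps power2_eq_square)
    also have "\<dots> + K * \<epsilon> = A * \<epsilon> + (2 * C * m b / \<theta> + 2 * K * (\<theta> / b\<^sup>2))"
      using \<theta> by (simp add: A_def field_simps)
    also have "\<dots> \<le> \<eta>" using A\<epsilon> b_small by simp
    finally have "\<bar>(\<integral>\<omega>. exp_neg (ereal l * walk_hitting_time (random_walk \<xi>) (- D) \<omega>) \<partial>M) - v 0\<bar> \<le> \<eta>" .
    moreover have "- D = {x. b \<le> p x}" by (auto simp: D_def)
    moreover have "v 0 = g 0" using \<epsilon> by (simp add: v_def p0)
    ultimately show ?thesis
      using b by (simp add: scaled_hitting_time l_def)
  qed
  have "eventually (\<lambda>i. B \<le> b i) F"
    using b_at_top by (auto simp: filterlim_at_top)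
  then show "\<forall>\<^sub>F i in F. dist (\<integral>\<omega>. exp_neg (ereal \<theta> * walk_hitting_time (random_walk (\<xi> i)) {x. b i \<le> p x} \<omega> / ereal ((b i)\<^sup>2)) \<partial>M i) (g 0) < \<eta>'"
  proof eventually_elim
    case (elim i)
    show ?case using near[OF elim walks[of i]] \<eta> by (simp add: dist_real_def)
  qed
qed

lemma exp_quadratic_remainder: "\<bar>exp s - 1 - s - s\<^sup>2 / 2\<bar> \<le> exp \<bar>s\<bar> * \<bar>s\<bar> ^ 3" for s :: real
proof -
  obtain t where t: "\<bar>t\<bar> \<le> \<bar>s\<bar>" "exp s = (\<Sum>m<3. s ^ m / fact m) + exp t / fact 3 * s ^ 3"
    using Maclaurin_exp_le[of s 3] by blast
  then have "exp s - 1 - s - s\<^sup>2 / 2 = exp t / 6 * s ^ 3"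
    by (simp add: numeral_eq_Suc)
  then have "\<bar>exp s - 1 - s - s\<^sup>2 / 2\<bar> = exp t / 6 * \<bar>s\<bar> ^ 3"
    by (simp only: abs_mult power_abs abs_divide abs_exp_cancel abs_numeral)
  also have "\<dots> \<le> exp \<bar>s\<bar> * \<bar>s\<bar> ^ 3"
  proof (rule mult_right_mono)
    have "exp t \<le> exp \<bar>s\<bar>" using t(1) by simp
    then show "exp t / 6 \<le> exp \<bar>s\<bar>" using exp_gt_zero[of t] by linarith
  qed simp
  finally show ?thesis .
qed

lemma exp_minus_one_bound: "\<bar>exp s - 1\<bar> \<le> exp \<bar>s\<bar> * \<bar>s\<bar>" for s :: real
proof -
  obtain t where t: "\<bar>t\<bar> \<le> \<bar>s\<bar>" "exp s = (\<Sum>m<1. s ^ m / fact m) + exp t / fact 1 * s ^ 1"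
    using Maclaurin_exp_le[of s 1] by blast
  then have "\<bar>exp s - 1\<bar> = exp t * \<bar>s\<bar>" by (simp add: abs_mult)
  also have "\<dots> \<le> exp \<bar>s\<bar> * \<bar>s\<bar>"
    using t(1) by (intro mult_right_mono) auto
  finally show ?thesis .
qed

text \<open>
  Both solutions of \<open>g'' = 2 \<theta> g\<close> are combinations of \<open>exp(c x)\<close> with \<open>c\<^sup>2 = 2 \<theta>\<close>, and this is their
  Taylor estimate.
\<close>

lemma exp_taylor:
  fixes c x y \<theta> :: real
  assumes "c\<^sup>2 = 2 * \<theta>" "\<bar>y\<bar> \<le> 1"
  shows "\<bar>exp (c * (x + y)) - exp (c * x) - c * exp (c * x) * y - \<theta> * exp (c * x) * y\<^sup>2\<bar>
    \<le> exp (c * x) * (exp \<bar>c\<bar> * \<bar>c\<bar> ^ 3) * \<bar>y\<bar> ^ 3"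
proof -
  have "\<theta> = c\<^sup>2 / 2" using assms(1) by simp
  then have "exp (c * (x + y)) - exp (c * x) - c * exp (c * x) * y - \<theta> * exp (c * x) * y\<^sup>2
      = exp (c * x) * (exp (c * y) - 1 - c * y - (c * y)\<^sup>2 / 2)"
    by (simp add: distrib_left exp_add algebra_simps power_mult_distrib)
  also have "\<bar>\<dots>\<bar> \<le> exp (c * x) * (exp \<bar>c * y\<bar> * \<bar>c * y\<bar> ^ 3)"
    unfolding abs_mult[of "exp (c * x)"] abs_exp_cancel
    by (intro mult_left_mono exp_quadratic_remainder) simp
  also have "\<dots> \<le> exp (c * x) * (exp \<bar>c\<bar> * \<bar>c * y\<bar> ^ 3)"
    using assms(2) by (intro mult_left_mono mult_right_mono) (auto simp: abs_mult mult_left_le)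
  finally show ?thesis by (simp add: abs_mult power_mult_distrib mult_ac)
qed

theorem two_sided_transform_limit:
  fixes \<mu> :: "real measure" and M :: "'i \<Rightarrow> 'a measure"
  assumes prob: "prob_space \<mu>" and sets[measurable_cong]: "sets \<mu> = sets borel"
    and mean: "has_bochner_integral \<mu> (\<lambda>x. x) 0" and var: "has_bochner_integral \<mu> (\<lambda>x. x\<^sup>2) 1"
    and \<theta>: "\<theta> > 0"
    and walks: "\<And>i. walk_with_law (M i) (\<xi> i) \<mu>" and b_at_top: "filterlim b at_top F"
  shows "((\<lambda>i. \<integral>\<omega>. exp_neg (ereal \<theta> * walk_hitting_time (random_walk (\<xi> i)) {x. b i \<le> \<bar>x\<bar>} \<omega> / ereal ((b i)\<^sup>2)) \<partial>M i)
    \<longlongrightarrow> sech (sqrt (2 * \<theta>))) F"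
proof -
  define a where "a = sqrt (2 * \<theta>)"
  have a: "a > 0" "a\<^sup>2 = 2 * \<theta>" "(- a)\<^sup>2 = 2 * \<theta>" using \<theta> by (auto simp: a_def)
  define g where "g x = (exp (a * x) + exp (- a * x)) / (exp a + exp (- a))" for x
  define g' where "g' x = (a * exp (a * x) + (- a) * exp (- a * x)) / (exp a + exp (- a))" for x
  define E where "E = exp a + exp (- a)"
  have E: "E > 0" "E \<ge> 1"
    using exp_ge_add_one_self[of a] a by (auto simp: E_def add_pos_pos intro: add_increasing2)
  \<comment> \<open>Dominates \<open>g\<close>, \<open>g'\<close> and the cubic remainder; all exponents involved are at most \<open>3 a\<close>.\<close>
  define K where "K = 4 * (1 + a + a ^ 3) * exp (3 * a)"
  have g_E: "g x = (exp (a * x) + exp (- a * x)) / E" and g'_E: "g' x = (a * exp (a * x) + (- a) * exp (- a * x)) / E" for x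
    by (simp_all add: g_def g'_def E_def)
  have div_E: "u / E \<le> u" if "u \<ge> 0" for u using that E by (simp add: divide_le_eq mult_le_cancel_left1)
  have exps: "exp (a * x) \<le> exp (2 * a)" "exp (- a * x) \<le> exp (2 * a)" if "\<bar>x\<bar> \<le> 2" for x
    using that a mult_left_mono[of x 2 a] mult_left_mono[of "- x" 2 a] by (auto simp: abs_le_iff mult.commute)
  have exp3: "exp (2 * a) \<le> exp (3 * a)" using a by simp
  have K1: "4 * exp (2 * a) \<le> K" "4 * a * exp (3 * a) \<le> K" "4 * a ^ 3 * exp (3 * a) \<le> K"
    using a exp3 mult_mono[of 4 "4 * (1 + a + a ^ 3)" "exp (2 * a)" "exp (3 * a)"] by (auto simp: K_def)
  have taylor: "\<bar>g (x + y) - g x - g' x * y - \<theta> * g x * y\<^sup>2\<bar> \<le> K * \<bar>y\<bar> ^ 3"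
    if "\<bar>x\<bar> < 1" "\<bar>y\<bar> \<le> 1" for x y
  proof -
    have "g (x + y) - g x - g' x * y - \<theta> * g x * y\<^sup>2 =
      ((exp (a * (x + y)) - exp (a * x) - a * exp (a * x) * y - \<theta> * exp (a * x) * y\<^sup>2)
       + (exp (- a * (x + y)) - exp (- a * x) - (- a) * exp (- a * x) * y - \<theta> * exp (- a * x) * y\<^sup>2)) / E"
      using E by (simp add: g_E g'_E field_simps)
    also have "\<bar>\<dots>\<bar> \<le> (exp (a * x) * (exp \<bar>a\<bar> * \<bar>a\<bar> ^ 3) * \<bar>y\<bar> ^ 3
        + exp (- a * x) * (exp \<bar>- a\<bar> * \<bar>- a\<bar> ^ 3) * \<bar>y\<bar> ^ 3) / E"
      using E exp_taylor[OF a(2) that(2), of x] exp_taylor[OF a(3) that(2), of x]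
      unfolding abs_divide
      by (simp only: abs_of_pos) (intro divide_right_mono order_trans[OF abs_triangle_ineq add_mono], auto)
    also have "\<dots> \<le> exp (a * x) * (exp \<bar>a\<bar> * \<bar>a\<bar> ^ 3) * \<bar>y\<bar> ^ 3
        + exp (- a * x) * (exp \<bar>- a\<bar> * \<bar>- a\<bar> ^ 3) * \<bar>y\<bar> ^ 3"
      by (rule div_E) simp
    also have "\<dots> \<le> exp (2 * a) * (exp a * a ^ 3) * \<bar>y\<bar> ^ 3 + exp (2 * a) * (exp a * a ^ 3) * \<bar>y\<bar> ^ 3"
      using that a exps[of x] by (intro add_mono mult_right_mono) auto
    also have "\<dots> = 2 * a ^ 3 * exp (3 * a) * \<bar>y\<bar> ^ 3"
      by (simp add: exp_add[symmetric] algebra_simps)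
    also have "\<dots> \<le> K * \<bar>y\<bar> ^ 3"
      using K1(3) a by (intro mult_right_mono) (auto intro: order_trans[rotated])
    finally show ?thesis .
  qed
  have g_bound: "\<bar>g x\<bar> \<le> K" if "\<bar>x\<bar> < 2" for x
  proof -
    have "\<bar>g x\<bar> = (exp (a * x) + exp (- a * x)) / E" using E by (simp add: g_E)
    also have "\<dots> \<le> exp (a * x) + exp (- a * x)" by (rule div_E) simp
    also have "\<dots> \<le> exp (2 * a) + exp (2 * a)" using that by (intro add_mono exps) auto
    also have "\<dots> \<le> K" using order_trans[OF _ K1(1), of "2 * exp (2 * a)"] by simp
    finally show ?thesis .
  qed
  have g'_bound: "\<bar>g' x\<bar> \<le> K" if "\<bar>x\<bar> < 1" for x
  proof -
    have "\<bar>g' x\<bar> = \<bar>a * exp (a * x) + (- a) * exp (- a * x)\<bar> / E"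
      unfolding g'_E abs_divide using E by simp
    also have "\<dots> \<le> \<bar>a * exp (a * x) + (- a) * exp (- a * x)\<bar>" by (rule div_E) simp
    also have "\<dots> \<le> a * exp (a * x) + a * exp (- a * x)"
      by (rule order_trans[OF abs_triangle_ineq]) (use a in \<open>simp add: abs_mult\<close>)
    also have "\<dots> \<le> a * exp (3 * a) + a * exp (3 * a)"
      using that a exps[of x] exp3 by (intro add_mono mult_left_mono) auto
    also have "\<dots> \<le> K" using order_trans[OF _ K1(2), of "2 * a * exp (3 * a)"] a by simp
    finally show ?thesis .
  qed
  have even: "g x = g \<bar>x\<bar>" for x by (simp add: g_def abs_if)
  have boundary: "\<bar>g x - 1\<bar> \<le> K * (\<bar>x\<bar> - 1)" if "1 \<le> \<bar>x\<bar>" "\<bar>x\<bar> < 2" for x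
  proof -
    define d where "d = \<bar>x\<bar> - 1"
    have d: "0 \<le> d" "d \<le> 1" using that by (auto simp: d_def)
    have x: "\<bar>x\<bar> = 1 + d" by (simp add: d_def)
    have "g x - 1 = (exp a * (exp (a * d) - 1) + exp (- a) * (exp (- a * d) - 1)) / E"
    proof -
      have "exp (a * (1 + d)) = exp a * exp (a * d)" "exp (- a * (1 + d)) = exp (- a) * exp (- a * d)"
        by (simp_all add: exp_add[symmetric] distrib_left)
      then have "g (1 + d) - 1 = (exp a * exp (a * d) + exp (- a) * exp (- a * d) - E) / E"
        using E by (simp add: g_E diff_divide_distrib)
      moreover have "g x = g (1 + d)" using even[of x] x by simp
      ultimately show ?thesis by (simp add: E_def algebra_simps)
    qed
    also have "\<bar>\<dots>\<bar> \<le> \<bar>exp a * (exp (a * d) - 1) + exp (- a) * (exp (- a * d) - 1)\<bar>"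
      unfolding abs_divide using E div_E by simp
    also have "\<dots> \<le> exp a * \<bar>exp (a * d) - 1\<bar> + exp (- a) * \<bar>exp (- a * d) - 1\<bar>"
      by (rule order_trans[OF abs_triangle_ineq]) (simp add: abs_mult)
    also have "\<dots> \<le> exp a * (exp a * (a * d)) + exp a * (exp a * (a * d))"
    proof (intro add_mono mult_mono)
      have ad: "\<bar>a * d\<bar> = a * d" "\<bar>- a * d\<bar> = a * d" using a d by (auto simp: abs_mult)
      have "exp (a * d) * (a * d) \<le> exp a * (a * d)"
        using a d by (intro mult_right_mono) (auto simp: mult_left_le)
      then show "\<bar>exp (a * d) - 1\<bar> \<le> exp a * (a * d)" "\<bar>exp (- a * d) - 1\<bar> \<le> exp a * (a * d)"
        using exp_minus_one_bound[of "a * d"] exp_minus_one_bound[of "- a * d"]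
        unfolding ad by linarith+
    qed (use a in auto)
    also have "\<dots> = 2 * a * exp (2 * a) * d" by (simp add: exp_add[symmetric] algebra_simps)
    also have "\<dots> \<le> K * d"
    proof (rule mult_right_mono[OF _ d(1)])
      have "2 * a * exp (2 * a) \<le> 4 * a * exp (3 * a)"
        using a exp3 by (intro mult_mono) auto
      then show "2 * a * exp (2 * a) \<le> K" using K1(2) by linarith
    qed
    finally show ?thesis by (simp add: d_def)
  qed
  have g0: "g 0 = sech (sqrt (2 * \<theta>))" by (simp add: g_def sech_altdef a_def)
  have gm: "g \<in> borel_measurable borel" unfolding g_def by measurable
  show ?thesis
    using hitting_transform_limit[where p=abs and g=g and g'=g' and K=K,
        OF prob sets mean var \<theta> _ _ _ gm taylor g_bound g'_bound boundary walks b_at_top]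
    by (auto simp: abs_mult g0 abs_triangle_ineq)
qed

theorem one_sided_transform_limit:
  fixes \<mu> :: "real measure" and M :: "'i \<Rightarrow> 'a measure"
  assumes prob: "prob_space \<mu>" and sets[measurable_cong]: "sets \<mu> = sets borel"
    and mean: "has_bochner_integral \<mu> (\<lambda>x. x) 0" and var: "has_bochner_integral \<mu> (\<lambda>x. x\<^sup>2) 1"
    and \<theta>: "\<theta> > 0"
    and walks: "\<And>i. walk_with_law (M i) (\<xi> i) \<mu>" and b_at_top: "filterlim b at_top F"
  shows "((\<lambda>i. \<integral>\<omega>. exp_neg (ereal \<theta> * walk_hitting_time (random_walk (\<xi> i)) {x. b i \<le> x} \<omega> / ereal ((b i)\<^sup>2)) \<partial>M i)
    \<longlongrightarrow> exp (- sqrt (2 * \<theta>))) F"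
proof -
  define a where "a = sqrt (2 * \<theta>)"
  have a: "a > 0" "a\<^sup>2 = 2 * \<theta>" using \<theta> by (auto simp: a_def)
  define g where "g x = exp (- a) * exp (a * x)" for x
  define g' where "g' x = a * g x" for x
  define K where "K = (1 + a + a ^ 3) * exp (2 * a)"
  have K1: "exp (2 * a) \<le> K" "a * exp (2 * a) \<le> K" "a ^ 3 * exp (2 * a) \<le> K"
    using a by (auto simp: K_def)
  have g_eq: "g x = exp (a * (x - 1))" for x
    by (simp add: g_def exp_add[symmetric] algebra_simps)
  have g_le: "g x \<le> exp (a * r)" if "x \<le> 1 + r" for x r
    using that a by (auto simp: g_eq intro!: mult_left_mono)
  have taylor: "\<bar>g (x + y) - g x - g' x * y - \<theta> * g x * y\<^sup>2\<bar> \<le> K * \<bar>y\<bar> ^ 3"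
    if "x < 1" "\<bar>y\<bar> \<le> 1" for x y
  proof -
    have "g (x + y) - g x - g' x * y - \<theta> * g x * y\<^sup>2 =
      exp (- a) * (exp (a * (x + y)) - exp (a * x) - a * exp (a * x) * y - \<theta> * exp (a * x) * y\<^sup>2)"
      by (simp add: g_def g'_def algebra_simps)
    also have "\<bar>\<dots>\<bar> \<le> exp (- a) * (exp (a * x) * (exp \<bar>a\<bar> * \<bar>a\<bar> ^ 3) * \<bar>y\<bar> ^ 3)"
      using exp_taylor[OF a(2) that(2), of x] unfolding abs_mult by simp
    also have "\<dots> = g x * (exp a * a ^ 3) * \<bar>y\<bar> ^ 3" using a by (simp add: g_def)
    also have "\<dots> \<le> 1 * (exp (2 * a) * a ^ 3) * \<bar>y\<bar> ^ 3"
      using g_le[of x 0] that a by (intro mult_right_mono mult_mono) (auto simp: g_eq)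
    also have "\<dots> \<le> K * \<bar>y\<bar> ^ 3" using K1(3) by (intro mult_right_mono) (auto simp: mult.commute)
    finally show ?thesis .
  qed
  have g_bound: "\<bar>g x\<bar> \<le> K" if "x < 2" for x
  proof -
    have "\<bar>g x\<bar> = g x" by (simp add: g_def)
    also have "\<dots> \<le> exp (a * 1)" using that by (intro g_le) simp
    also have "\<dots> \<le> exp (2 * a)" using a by simp
    finally show ?thesis using K1(1) by simp
  qed
  have g'_bound: "\<bar>g' x\<bar> \<le> K" if "x < 1" for x
  proof -
    have "\<bar>g' x\<bar> = a * g x" using a by (simp add: g'_def g_def)
    also have "\<dots> \<le> a * exp (2 * a)" using that a by (intro mult_left_mono g_le[of x 2, THEN order_trans]) (auto simp: mult.commute)
    finally show ?thesis using K1(2) by simp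
  qed
  have boundary: "\<bar>g x - 1\<bar> \<le> K * (x - 1)" if "1 \<le> x" "x < 2" for x
  proof -
    have "\<bar>g x - 1\<bar> \<le> exp (a * (x - 1)) * (a * (x - 1))"
      using exp_minus_one_bound[of "a * (x - 1)"] a that by (simp add: g_eq abs_mult)
    also have "\<dots> \<le> exp (2 * a) * (a * (x - 1))"
      using a that mult_left_mono[of "x - 1" 2 a] by (intro mult_right_mono) (auto simp: mult.commute)
    also have "\<dots> = a * exp (2 * a) * (x - 1)" by simp
    also have "\<dots> \<le> K * (x - 1)" using that K1(2) by (intro mult_right_mono) auto
    finally show ?thesis .
  qed
  have g0: "g 0 = exp (- sqrt (2 * \<theta>))" by (simp add: g_def a_def)
  have gm: "g \<in> borel_measurable borel" unfolding g_def by measurable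
  show ?thesis
    using hitting_transform_limit[where p="\<lambda>x. x" and g=g and g'=g' and K=K,
        OF prob sets mean var \<theta> _ _ _ gm taylor g_bound g'_bound boundary walks b_at_top]
    by (auto simp: g0)
qed

section \<open>Brownian motion seen through Gaussian walks\<close>

lemma std_normal_moments:
  fixes \<mu> :: "real measure"
  defines "\<mu> \<equiv> density lborel std_normal_density"
  shows "prob_space \<mu>" "sets \<mu> = sets borel"
    "has_bochner_integral \<mu> (\<lambda>x. x) 0" "has_bochner_integral \<mu> (\<lambda>x. x\<^sup>2) 1"
proof -
  show "prob_space \<mu>" unfolding \<mu>_def by (rule prob_space_normal_density) simp
  show "sets \<mu> = sets borel" by (simp add: \<mu>_def)
  show "has_bochner_integral \<mu> (\<lambda>x. x) 0"
    unfolding \<mu>_def using std_normal_moment_odd[of 0]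
    by (intro has_bochner_integral_density) (auto simp: normal_density_nonneg)
  show "has_bochner_integral \<mu> (\<lambda>x. x\<^sup>2) 1"
    unfolding \<mu>_def using std_normal_moment_even[of 1]
    by (intro has_bochner_integral_density) (auto simp: normal_density_nonneg)
qed

text \<open>
  At \<open>k = 0\<close> the truncated subtraction makes the step \<open>0\<close>; the steps that count have index \<open>k \<ge> 1\<close>.
\<close>

definition brownian_step :: "(real \<Rightarrow> 'b \<Rightarrow> real) \<Rightarrow> nat \<Rightarrow> nat \<Rightarrow> 'b \<Rightarrow> real" where
  "brownian_step W n k \<omega> = sqrt (real n) * (W (real k / real n) \<omega> - W (real (k - 1) / real n) \<omega>)"

lemma random_walk_brownian_step:
  "random_walk (brownian_step W n) k \<omega> = sqrt (real n) * (W (real k / real n) \<omega> - W 0 \<omega>)"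
  by (induction k) (auto simp: brownian_step_def algebra_simps)

lemma walk_with_law_brownian_step:
  assumes BM: "standard_brownian_motion N W" and n: "n > 0"
  shows "walk_with_law N (brownian_step W n) (density lborel std_normal_density)"
proof -
  interpret prob_space N using BM by (simp add: standard_brownian_motion_def)
  \<comment> \<open>Starting the partition with \<open>0, 0\<close> aligns the indices: increment \<open>i\<close> is the step \<open>i\<close> of the
    walk, and increment \<open>0\<close> is trivial.\<close>
  define t where "t i = real (i - 1) / real n" for i :: nat
  define X where "X i \<omega> = W (t (Suc i)) \<omega> - W (t i) \<omega>" for i \<omega>
  have t: "0 \<le> t 0" "\<forall>i<m. t i \<le> t (Suc i)" for m
    using n by (auto simp: t_def divide_right_mono)
  have indep_m: "indep_vars (\<lambda>_. borel) X {..<m}" for m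
    unfolding X_def[abs_def] using BM t(1) t(2)[of m] unfolding standard_brownian_motion_def by blast
  have "indep_vars (\<lambda>_. borel) X {1..}"
    unfolding indep_vars_def2
  proof (intro conjI ballI)
    fix i :: nat
    show "random_variable borel (X i)" using indep_m[of "Suc i"] by (auto simp: indep_vars_def2)
    show "indep_sets (\<lambda>i. {X i -` A \<inter> space N |A. A \<in> sets borel}) {1..}"
      unfolding indep_sets_finite_index_sets[of _ "{1..}"]
    proof (intro allI impI)
      fix J :: "nat set" assume "finite J"
      then obtain m where "J \<subseteq> {..<m}" using finite_nat_iff_bounded by auto
      then show "indep_sets (\<lambda>i. {X i -` A \<inter> space N |A. A \<in> sets borel}) J"
        using indep_m[of m] unfolding indep_vars_def2 by (blast intro: indep_sets_mono_index)
    qed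
  qed
  then have "indep_vars (\<lambda>_. borel) (\<lambda>i \<omega>. sqrt (real n) * X i \<omega>) {1..}"
    by (rule indep_vars_compose2) simp
  moreover have "(\<lambda>i \<omega>. sqrt (real n) * X i \<omega>) = brownian_step W n"
    by (simp add: fun_eq_iff X_def t_def brownian_step_def)
  ultimately have indep: "indep_vars (\<lambda>_. borel) (brownian_step W n) {1..}" by simp
  show ?thesis
  proof
    show "indep_vars (\<lambda>_. borel) (brownian_step W n) {1..}" by (rule indep)
    fix i :: nat
    assume i: "1 \<le> i"
    define d where "d = real i / real n - real (i - 1) / real n"
    have d: "d = 1 / real n" using i by (simp add: d_def of_nat_diff diff_divide_distrib)
    have D: "distributed N lborel (\<lambda>\<omega>. W (real i / real n) \<omega> - W (real (i - 1) / real n) \<omega>)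
        (\<lambda>x. ennreal (normal_density 0 (sqrt d) x))"
      using BM n i unfolding standard_brownian_motion_def d_def
      by (auto simp: divide_strict_right_mono)
    have "distributed N lborel (brownian_step W n i) std_normal_density"
      using normal_density_affine[OF D, of "sqrt (real n)" 0] n
      by (simp add: d brownian_step_def[abs_def] real_sqrt_mult[symmetric])
    then have "distr N lborel (brownian_step W n i) = density lborel std_normal_density"
      by (rule distributed_distr_eq_density)
    moreover have "distr N borel (brownian_step W n i) = distr N lborel (brownian_step W n i)"
      by (rule distr_cong) auto
    ultimately show "distr N borel (brownian_step W n i) = density lborel std_normal_density" by simp
  qed
qed

text \<open>
  The times at which a continuous path is in a closed target form a closed set, so that the infimum
  is attained unless the set is empty.
\<close>

lemma process_hitting_time_cases:
  fixes W :: "real \<Rightarrow> 'b \<Rightarrow> real"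
  assumes cont: "continuous_on {0..} (\<lambda>t. W t \<omega>)" and A: "closed A"
  obtains (never) "\<And>s. 0 \<le> s \<Longrightarrow> W s \<omega> \<notin> A" "process_hitting_time W A \<omega> = \<infinity>"
  | (first) t where "0 \<le> t" "W t \<omega> \<in> A" "\<And>s. 0 \<le> s \<Longrightarrow> W s \<omega> \<in> A \<Longrightarrow> t \<le> s"
      "process_hitting_time W A \<omega> = ereal t"
proof (cases "{t. 0 \<le> t \<and> W t \<omega> \<in> A} = {}")
  case True
  then have "process_hitting_time W A \<omega> = \<infinity>"
    unfolding process_hitting_time_def True by (simp add: top_ereal_def)
  with True show ?thesis using never by blast
next
  case False
  define H where "H = {t. 0 \<le> t \<and> W t \<omega> \<in> A}"
  have "H = {0..} \<inter> (\<lambda>t. W t \<omega>) -` A" by (auto simp: H_def)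
  then have "closed H" using continuous_closed_preimage[OF cont _ A] by simp
  moreover have bdd: "bdd_below H" by (rule bdd_belowI[of _ 0]) (auto simp: H_def)
  ultimately have Inf: "Inf H \<in> H"
    using False by (intro closed_contains_Inf) (auto simp: H_def)
  have le: "Inf H \<le> s" if "0 \<le> s" "W s \<omega> \<in> A" for s
    using that bdd by (intro cInf_lower) (auto simp: H_def)
  have "process_hitting_time W A \<omega> = ereal (Inf H)"
    unfolding process_hitting_time_def H_def[symmetric]
    by (intro antisym INF_greatest INF_lower2[OF Inf]) (auto simp: H_def intro: le[unfolded H_def])
  then show ?thesis using first[of "Inf H"] Inf le by (auto simp: H_def)
qed

text \<open>
  Avoiding a value on \<open>[0, t]\<close> is an uncountable condition on the path. Compactness makes it
  equivalent to a countable one. Rationals are clamped to \<open>[0, t]\<close> so that the endpoint \<open>t\<close>, which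
  may be irrational, is covered.
\<close>

lemma continuous_avoids_iff_rationally_bounded_away:
  fixes f :: "real \<Rightarrow> real"
  assumes cont: "continuous_on {0..} f" and t: "0 \<le> t"
  shows "(\<forall>s\<in>{0..t}. f s \<noteq> 0) \<longleftrightarrow>
    (\<exists>m. \<forall>q::rat. 1 / real (Suc m) \<le> \<bar>f (min t (max 0 (of_rat q)))\<bar>)"
proof
  assume nz: "\<forall>s\<in>{0..t}. f s \<noteq> 0"
  have "continuous_on {0..t} (\<lambda>s. \<bar>f s\<bar>)"
    using continuous_on_subset[OF cont, of "{0..t}"] by (intro continuous_intros) auto
  then obtain s where s: "s \<in> {0..t}" "\<And>r. r \<in> {0..t} \<Longrightarrow> \<bar>f s\<bar> \<le> \<bar>f r\<bar>"
    using continuous_attains_inf[of "{0..t}" "\<lambda>s. \<bar>f s\<bar>"] t by auto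
  have "\<bar>f s\<bar> > 0" using nz s(1) by auto
  then obtain m where "1 / real (Suc m) < \<bar>f s\<bar>"
    using reals_Archimedean by (metis inverse_eq_divide)
  then have "1 / real (Suc m) \<le> \<bar>f (min t (max 0 (of_rat q)))\<bar>" for q
    using s(2)[of "min t (max 0 (of_rat q))"] t by auto
  then show "\<exists>m. \<forall>q::rat. 1 / real (Suc m) \<le> \<bar>f (min t (max 0 (of_rat q)))\<bar>" by blast
next
  assume "\<exists>m. \<forall>q::rat. 1 / real (Suc m) \<le> \<bar>f (min t (max 0 (of_rat q)))\<bar>"
  then obtain m where m: "\<And>q::rat. 1 / real (Suc m) \<le> \<bar>f (min t (max 0 (of_rat q)))\<bar>" by blast
  define h where "h r = \<bar>f (min t (max 0 r))\<bar>" for r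
  have "continuous_on UNIV h"
    unfolding h_def using t
    by (intro continuous_intros continuous_on_compose2[OF cont]) auto
  then have op: "open {r. h r < 1 / real (Suc m)}"
    using open_Collect_less[of h "\<lambda>_. 1 / real (Suc m)"] by simp
  show "\<forall>s\<in>{0..t}. f s \<noteq> 0"
  proof (intro ballI notI)
    fix s assume s: "s \<in> {0..t}" "f s = 0"
    then have "s \<in> {r. h r < 1 / real (Suc m)}" by (simp add: h_def)
    then obtain e where e: "e > 0" "\<And>r. dist r s < e \<Longrightarrow> h r < 1 / real (Suc m)"
      using op unfolding open_dist by blast
    obtain q :: rat where "s < of_rat q" "of_rat q < s + e"
      using of_rat_dense[of s "s + e"] e(1) by auto
    then have "h (of_rat q) < 1 / real (Suc m)" by (intro e(2)) (simp add: dist_real_def)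
    with m[of q] show False by (simp add: h_def)
  qed
qed

text \<open>
  The event that the hitting time exceeds \<open>t\<close> says that the continuous path avoids the target on
  \<open>[0, t]\<close>, which is a countable condition on the coordinates.
\<close>

lemma process_hitting_time_measurable:
  assumes meas: "\<And>t. 0 \<le> t \<Longrightarrow> W t \<in> borel_measurable N"
    and cont: "\<And>\<omega>. \<omega> \<in> space N \<Longrightarrow> continuous_on {0..} (\<lambda>t. W t \<omega>)"
    and p: "continuous_on UNIV p"
  shows "process_hitting_time W {x. p x = (1::real)} \<in> borel_measurable N"
proof (rule borel_measurableI_greater)
  fix y :: ereal
  let ?T = "process_hitting_time W {x. p x = (1::real)}"
  have A: "closed {x. p x = 1}" using p by (intro closed_Collect_eq) auto
  have T0: "0 \<le> ?T \<omega>" for \<omega>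
    unfolding process_hitting_time_def by (intro INF_greatest) auto
  consider "y = \<infinity>" | "y < 0" | t where "0 \<le> t" "y = ereal t"
    by (cases y) force+
  then show "{\<omega> \<in> space N. y < ?T \<omega>} \<in> sets N"
  proof cases
    case 1 then show ?thesis by simp
  next
    case 2
    then have "{\<omega> \<in> space N. y < ?T \<omega>} = space N" using T0 by (auto intro: less_le_trans)
    then show ?thesis by simp
  next
    case (3 t)
    have pm[measurable]: "p \<in> borel_measurable borel"
      using p by (rule borel_measurable_continuous_onI)
    have Wm[measurable]: "W (min t (max 0 (of_rat q))) \<in> borel_measurable N" for q :: rat
      using 3 by (intro meas) auto
    have "y < ?T \<omega> \<longleftrightarrow> (\<exists>m. \<forall>q::rat. 1 / real (Suc m) \<le> \<bar>p (W (min t (max 0 (of_rat q))) \<omega>) - 1\<bar>)"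
      if \<omega>: "\<omega> \<in> space N" for \<omega>
    proof -
      have "continuous_on {0..} (\<lambda>s. p (W s \<omega>) - 1)"
        using cont[OF \<omega>] p by (intro continuous_intros) (auto intro: continuous_on_compose2)
      note iff = continuous_avoids_iff_rationally_bounded_away[OF this \<open>0 \<le> t\<close>]
      have "y < ?T \<omega> \<longleftrightarrow> (\<forall>s\<in>{0..t}. p (W s \<omega>) - 1 \<noteq> 0)"
        using cont[OF \<omega>] A
      proof (cases rule: process_hitting_time_cases)
        case never
        then show ?thesis using 3 by auto
      next
        case (first s)
        then have "y < ?T \<omega> \<longleftrightarrow> t < s" using 3 by simp
        also have "\<dots> \<longleftrightarrow> (\<forall>s\<in>{0..t}. p (W s \<omega>) - 1 \<noteq> 0)"
          using first(1-3) by (force simp: not_less)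
        finally show ?thesis .
      qed
      then show ?thesis using iff by simp
    qed
    then have "{\<omega> \<in> space N. y < ?T \<omega>} =
        {\<omega> \<in> space N. \<exists>m. \<forall>q::rat. 1 / real (Suc m) \<le> \<bar>p (W (min t (max 0 (of_rat q))) \<omega>) - 1\<bar>}"
      by auto
    also have "\<dots> \<in> sets N" by measurable
    finally show ?thesis .
  qed
qed

lemma exp_neg_measurable [measurable]: "exp_neg \<in> borel_measurable borel"
  unfolding exp_neg_def[abs_def] by measurable

lemma exp_neg_bounds: "0 \<le> x \<Longrightarrow> 0 \<le> exp_neg x \<and> exp_neg x \<le> 1"
  by (cases x) (auto simp: exp_neg_def)

text \<open>
  Let \<open>R c n\<close> be \<open>e\<^sup>-\<^sup>\<theta>\<^sup>s\<close>, where \<open>s\<close> is the first multiple of \<open>1 / (n + 1)\<close> at which \<open>p(W) \<ge> c\<close>.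
  For \<open>c = 1\<close> the intermediate value theorem gives \<open>R 1 n \<le> e\<^sup>-\<^sup>\<theta>\<^sup>T\<close>. For \<open>c < 1\<close> the path stays above \<open>c\<close> for a while after \<open>T\<close>, so some sampling time soon after \<open>T\<close> counts, and \<open>e\<^sup>-\<^sup>\<theta>\<^sup>T\<close>
  exceeds \<open>R c n\<close> by a vanishing amount. As the expectation of \<open>R c n\<close> tends to \<open>L(\<theta> c\<^sup>2)\<close> by scaling,
  continuity of \<open>L\<close> closes the gap. Lower levels are used because a path that reaches
  the level \<open>1\<close> may turn back at once and be missed by the samples.
\<close>

theorem brownian_hitting_transform:
  fixes W :: "real \<Rightarrow> 'b \<Rightarrow> real" and p L :: "real \<Rightarrow> real"
  assumes BM: "standard_brownian_motion N W"
    and p: "continuous_on UNIV p" and p_scale: "\<And>c x. c \<ge> 0 \<Longrightarrow> p (c * x) = c * p x"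
    and walk_limit: "\<And>\<theta> (\<xi> :: nat \<Rightarrow> nat \<Rightarrow> 'b \<Rightarrow> real) b. \<theta> > 0 \<Longrightarrow>
        (\<And>n. walk_with_law N (\<xi> n) (density lborel std_normal_density)) \<Longrightarrow>
        filterlim b at_top sequentially \<Longrightarrow>
        (\<lambda>n. \<integral>\<omega>. exp_neg (ereal \<theta> * walk_hitting_time (random_walk (\<xi> n)) {x. b n \<le> p x} \<omega>
            / ereal ((b n)\<^sup>2)) \<partial>N) \<longlonglongrightarrow> L \<theta>"
    and \<theta>: "\<theta> > 0" and L: "isCont L \<theta>"
  shows "(\<integral>\<omega>. exp_neg (ereal \<theta> * process_hitting_time W {x. p x = 1} \<omega>) \<partial>N) = L \<theta>"
proof -
  interpret prob_space N using BM by (simp add: standard_brownian_motion_def)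
  have meas: "\<And>t. 0 \<le> t \<Longrightarrow> W t \<in> borel_measurable N"
    and cont: "\<And>\<omega>. \<omega> \<in> space N \<Longrightarrow> continuous_on {0..} (\<lambda>t. W t \<omega>)"
    and start: "AE \<omega> in N. W 0 \<omega> = 0"
    using BM by (auto simp: standard_brownian_motion_def)
  have p0: "p 0 = 0" using p_scale[of 0 0] by simp
  have pm[measurable]: "p \<in> borel_measurable borel"
    using p by (rule borel_measurable_continuous_onI)
  have A: "closed {x. p x = 1}" using p by (intro closed_Collect_eq) auto
  define T where "T = process_hitting_time W {x. p x = 1}"
  have [measurable]: "T \<in> borel_measurable N"
    unfolding T_def by (rule process_hitting_time_measurable[OF meas cont p])
  have T0: "0 \<le> T \<omega>" for \<omega>
    unfolding T_def process_hitting_time_def by (intro INF_greatest) auto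
  define G where "G \<omega> = exp_neg (ereal \<theta> * T \<omega>)" for \<omega>
  have [measurable]: "G \<in> borel_measurable N" unfolding G_def by measurable
  have G01: "0 \<le> G \<omega>" "G \<omega> \<le> 1" for \<omega>
    using exp_neg_bounds[of "ereal \<theta> * T \<omega>"] T0 \<theta> by (auto simp: G_def)
  have G_int: "integrable N G" by (rule integrable_const_bound[where B=1]) (auto simp: G01)
  define X where "X n = brownian_step W (Suc n)" for n
  have X: "walk_with_law N (X n) (density lborel std_normal_density)" for n
    unfolding X_def by (rule walk_with_law_brownian_step[OF BM]) simp
  define lev where "lev c n = c * sqrt (real (Suc n))" for c n
  define R where "R c n \<omega> = exp_neg (ereal (\<theta> / real (Suc n)) *
      walk_hitting_time (random_walk (X n)) {x. lev c n \<le> p x} \<omega>)" for c n \<omega>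
  have R_eq: "R c n \<omega> = exit_value (\<theta> / real (Suc n)) {x. p x < lev c n} (\<lambda>_. 1) (\<lambda>t. random_walk (X n) t \<omega>)"
    for c n \<omega>
  proof -
    have "{x. lev c n \<le> p x} = - {x. p x < lev c n}" by auto
    then show ?thesis
      unfolding R_def using \<theta> by (simp add: exp_neg_walk_hitting_time_eq_exit_value)
  qed
  have R_meas[measurable]: "R c n \<in> borel_measurable N" for c n
    unfolding R_eq[abs_def]
    by (rule walk_with_law.exit_value_measurable[OF X, where C=1]) (use \<theta> in auto)
  have R01: "0 \<le> R c n \<omega>" "R c n \<omega> \<le> 1" for c n \<omega>
    unfolding R_eq exit_value_def using \<theta> by auto
  have R_int: "integrable N (R c n)" for c n
    by (rule integrable_const_bound[where B=1]) (auto simp: R01)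
  have R_lim: "(\<lambda>n. expectation (R c n)) \<longlonglongrightarrow> L (\<theta> * c\<^sup>2)" if c: "c > 0" for c
  proof -
    have "filterlim (lev c) at_top sequentially"
      unfolding lev_def using c
      by (intro filterlim_tendsto_pos_mult_at_top[OF tendsto_const] filterlim_compose[OF sqrt_at_top]
          filterlim_compose[OF filterlim_real_sequentially filterlim_Suc])
    from walk_limit[where \<xi>=X, OF _ X this, of "\<theta> * c\<^sup>2"] c \<theta>
    show ?thesis
      by (simp add: R_def[abs_def] scaled_hitting_time lev_def power_mult_distrib)
  qed
  have hit: "random_walk (X n) k \<omega> \<in> {x. lev c n \<le> p x} \<longleftrightarrow> c \<le> p (W (real k / real (Suc n)) \<omega>)"
    if "W 0 \<omega> = 0" for c n k \<omega>
    using that by (simp add: X_def random_walk_brownian_step lev_def p_scale mult.commute)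
  have R_le_G: "R 1 n \<omega> \<le> G \<omega>" if \<omega>: "\<omega> \<in> space N" "W 0 \<omega> = 0" for n \<omega>
  proof (cases "\<exists>k. random_walk (X n) k \<omega> \<in> {x. lev 1 n \<le> p x}")
    case False
    then show ?thesis
      using G01 \<theta> unfolding R_def by (subst exp_neg_walk_hitting_time) auto
  next
    case True
    define k where "k = (LEAST k. random_walk (X n) k \<omega> \<in> {x. lev 1 n \<le> p x})"
    define s where "s = real k / real (Suc n)"
    have "random_walk (X n) k \<omega> \<in> {x. lev 1 n \<le> p x}"
      unfolding k_def using True by (rule LeastI_ex)
    then have ps: "1 \<le> p (W s \<omega>)" unfolding hit[OF \<omega>(2)] s_def .
    have s0: "0 \<le> s" by (simp add: s_def)
    have "continuous_on {0..s} (\<lambda>r. p (W r \<omega>))"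
      using continuous_on_subset[OF cont[OF \<omega>(1)], of "{0..s}"] p
      by (auto intro: continuous_on_compose2)
    then obtain r where r: "0 \<le> r" "r \<le> s" "p (W r \<omega>) = 1"
      using IVT'[of "\<lambda>r. p (W r \<omega>)" 0 1 s] ps s0 \<omega>(2) p0 by auto
    have "exp (- \<theta> * s) \<le> G \<omega>"
      using cont[OF \<omega>(1)] A
    proof (cases rule: process_hitting_time_cases)
      case never then show ?thesis using r by auto
    next
      case (first t)
      then have "t \<le> s" using r by force
      then have "exp (- \<theta> * s) \<le> exp (- \<theta> * t)" using \<theta> by simp
      then show ?thesis using first by (simp add: G_def T_def exp_neg_def)
    qed
    moreover have "R 1 n \<omega> = exp (- \<theta> * s)"
      unfolding R_def using \<theta> True
      by (subst exp_neg_walk_hitting_time) (auto simp: k_def s_def)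
    ultimately show ?thesis by simp
  qed
  have G_R: "(\<lambda>n. max 0 (G \<omega> - R c n \<omega>)) \<longlonglongrightarrow> 0"
    if \<omega>: "\<omega> \<in> space N" "W 0 \<omega> = 0" and c: "c < 1" for c \<omega>
    using cont[OF \<omega>(1)] A
  proof (cases rule: process_hitting_time_cases)
    case never
    then have "G \<omega> = 0" using \<theta> by (simp add: G_def T_def exp_neg_def)
    then have "max 0 (G \<omega> - R c n \<omega>) = 0" for n using R01[of c n \<omega>] by simp
    then show ?thesis by simp
  next
    case (first t)
    have G: "G \<omega> = exp (- \<theta> * t)" using first by (simp add: G_def T_def exp_neg_def)
    have pc: "continuous_on {0..} (\<lambda>r. p (W r \<omega>))"
      using cont[OF \<omega>(1)] p by (auto intro: continuous_on_compose2)
    show ?thesis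
    proof (rule LIMSEQ_I)
      fix e :: real assume e: "e > 0"
      obtain d' where d': "d' > 0" "\<And>r. r \<in> {0..} \<Longrightarrow> dist r t < d' \<Longrightarrow> dist (p (W r \<omega>)) (p (W t \<omega>)) < 1 - c"
        using pc[unfolded continuous_on_iff, rule_format, of t "1 - c"] first(1) c by auto
      \<comment> \<open>During \<open>[t, t + d]\<close> the path stays above \<open>c\<close>, and a delay of \<open>d\<close> costs less than \<open>e\<close> in the
        transform.\<close>
      define d where "d = min (d' / 2) (e / (2 * \<theta>))"
      have d: "d > 0" "d < d'" "\<theta> * d < e" using d'(1) e \<theta> by (auto simp: d_def min_def field_simps)
      obtain n0 where n0: "1 / d < real n0" using reals_Archimedean2 by blast
      show "\<exists>n0. \<forall>n\<ge>n0. norm (max 0 (G \<omega> - R c n \<omega>) - 0) < e"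
      proof (intro exI[of _ n0] allI impI)
        fix n assume n: "n0 \<le> n"
        \<comment> \<open>The first sampling time not before \<open>t\<close>.\<close>
        define k where "k = nat \<lceil>t * real (Suc n)\<rceil>"
        define s where "s = real k / real (Suc n)"
        have "real k = of_int \<lceil>t * real (Suc n)\<rceil>" using first(1) by (simp add: k_def)
        then have k: "t * real (Suc n) \<le> real k" "real k < t * real (Suc n) + 1" by linarith+
        have ts: "t \<le> s" using k(1) by (simp add: s_def field_simps)
        have "s < t + 1 / real (Suc n)" 
          using divide_strict_right_mono[OF k(2), of "real (Suc n)"]
          by (simp add: s_def add_divide_distrib del: of_nat_Suc)
        moreover have "1 / real (Suc n) < d"
        proof -
          have "1 / d < real (Suc n)" using n0 n by linarith
          then show ?thesis using d(1) by (simp add: field_simps)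
        qed
        ultimately have s: "t \<le> s" "s < t + d" using ts by auto
        have "dist (p (W s \<omega>)) (p (W t \<omega>)) < 1 - c"
          using s first(1) d by (intro d'(2)) (auto simp: dist_real_def)
        then have "c \<le> p (W s \<omega>)" using first(2) by (simp add: dist_real_def)
        then have hk: "random_walk (X n) k \<omega> \<in> {x. lev c n \<le> p x}"
          unfolding hit[OF \<omega>(2)] s_def .
        define K where "K = (LEAST k. random_walk (X n) k \<omega> \<in> {x. lev c n \<le> p x})"
        have "K \<le> k" unfolding K_def using hk by (rule Least_le)
        then have Ks: "real K / real (Suc n) \<le> s" by (simp add: s_def divide_right_mono)
        have "R c n \<omega> = exp (- \<theta> * (real K / real (Suc n)))"
          unfolding R_def using \<theta> hk
          by (subst exp_neg_walk_hitting_time) (auto simp: K_def)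
        moreover have "exp (- \<theta> * s) \<le> exp (- \<theta> * (real K / real (Suc n)))"
          using Ks \<theta> by (simp only: exp_le_cancel_iff) (intro mult_left_mono_neg, auto)
        ultimately have "G \<omega> - R c n \<omega> \<le> exp (- \<theta> * t) - exp (- \<theta> * s)" by (simp add: G)
        also have "\<dots> = exp (- \<theta> * t) * (1 - exp (- (\<theta> * (s - t))))"
        proof -
          have "exp (- \<theta> * s) = exp (- \<theta> * t) * exp (- (\<theta> * (s - t)))"
            by (simp add: exp_add[symmetric] algebra_simps)
          then show ?thesis by (simp add: right_diff_distrib)
        qed
        also have "\<dots> \<le> 1 * (\<theta> * (s - t))"
          using exp_ge_add_one_self[of "- (\<theta> * (s - t))"] s first(1) \<theta>
          by (intro mult_mono) auto
        also have "\<dots> \<le> \<theta> * d" using s \<theta> by simp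
        finally show "norm (max 0 (G \<omega> - R c n \<omega>) - 0) < e" using d e by simp
      qed
    qed
  qed
  have lower: "L \<theta> \<le> expectation G"
  proof (rule LIMSEQ_le_const2)
    show "(\<lambda>n. expectation (R 1 n)) \<longlonglongrightarrow> L \<theta>" using R_lim[of 1] by simp
    have "AE \<omega> in N. R 1 n \<omega> \<le> G \<omega>" for n
      using start by (rule AE_mp) (auto intro!: AE_I2 R_le_G)
    then show "\<exists>n0. \<forall>n\<ge>n0. expectation (R 1 n) \<le> expectation G"
      using R_int G_int by (intro exI[of _ 0] allI impI integral_mono_AE) auto
  qed
  have upper_c: "expectation G \<le> L (\<theta> * c\<^sup>2)" if c: "0 < c" "c < 1" for c
  proof -
    have "(\<lambda>n. \<integral>\<omega>. max 0 (G \<omega> - R c n \<omega>) \<partial>N) \<longlonglongrightarrow> (\<integral>\<omega>. 0 \<partial>N)"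
    proof (rule integral_dominated_convergence[where w="\<lambda>_. 1"])
      show "AE \<omega> in N. (\<lambda>n. max 0 (G \<omega> - R c n \<omega>)) \<longlonglongrightarrow> 0"
        using start by (rule AE_mp) (auto intro!: AE_I2 G_R c)
      show "AE \<omega> in N. norm (max 0 (G \<omega> - R c n \<omega>)) \<le> 1" for n
      proof (rule AE_I2)
        fix \<omega> show "norm (max 0 (G \<omega> - R c n \<omega>)) \<le> 1"
          using G01(2)[of \<omega>] R01(1)[of c n \<omega>] by simp
      qed
    qed auto
    then have "(\<lambda>n. expectation (R c n) + (\<integral>\<omega>. max 0 (G \<omega> - R c n \<omega>) \<partial>N)) \<longlonglongrightarrow> L (\<theta> * c\<^sup>2) + 0"
      using R_lim[OF c(1)] by (intro tendsto_add) auto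
    moreover have "expectation G \<le> expectation (R c n) + (\<integral>\<omega>. max 0 (G \<omega> - R c n \<omega>) \<partial>N)" for n
    proof -
      have i: "integrable N (\<lambda>\<omega>. max 0 (G \<omega> - R c n \<omega>))"
        using G_int R_int by (intro integrable_max) auto
      have "expectation G \<le> (\<integral>\<omega>. R c n \<omega> + max 0 (G \<omega> - R c n \<omega>) \<partial>N)"
        using G_int R_int i by (intro integral_mono) auto
      then show ?thesis using R_int i by simp
    qed
    ultimately show ?thesis by (auto intro: LIMSEQ_le_const)
  qed
  have "expectation G \<le> L \<theta>"
  proof (rule LIMSEQ_le_const)
    define c where "c n = 1 - 1 / real (Suc (Suc n))" for n
    have "c \<longlonglongrightarrow> 1 - 0"
      unfolding c_def
      by (intro tendsto_diff tendsto_const filterlim_compose[OF lim_1_over_n] filterlim_compose[OF filterlim_Suc filterlim_Suc])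
    then have "(\<lambda>n. \<theta> * (c n)\<^sup>2) \<longlonglongrightarrow> \<theta> * (1 - 0)\<^sup>2" by (intro tendsto_intros)
    then show "(\<lambda>n. L (\<theta> * (c n)\<^sup>2)) \<longlonglongrightarrow> L \<theta>"
      using isCont_tendsto_compose[OF L] by simp
    show "\<exists>n0. \<forall>n\<ge>n0. expectation G \<le> L (\<theta> * (c n)\<^sup>2)"
      by (intro exI[of _ 0] allI impI upper_c) (auto simp: c_def field_simps)
  qed
  with lower show ?thesis by (simp add: G_def[abs_def] T_def)
qed

section \<open>Characteristic functions of lattice laws\<close>

text \<open>
  Both bounds compare \<open>\<phi>(u)\<close> with \<open>1 - u\<^sup>2 / 2\<close>: the difference is at most \<open>u\<^sup>2\<close> everywhere and
  \<open>o(u\<^sup>2)\<close> near \<open>0\<close>.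
\<close>

lemma (in real_distribution) char_quadratic_bounds:
  assumes mean: "has_bochner_integral M (\<lambda>x. x) 0" and var: "has_bochner_integral M (\<lambda>x. x\<^sup>2) 1"
  shows "cmod (1 - char M u) \<le> 2 * u\<^sup>2"
    and "\<exists>u0>0. \<forall>u. \<bar>u\<bar> \<le> u0 \<longrightarrow> u\<^sup>2 / 3 \<le> Re (1 - char M u)"
proof -
  have int1: "integrable M (\<lambda>x. x)" "(\<integral>x. x \<partial>M) = 0"
    and int2: "integrable M (\<lambda>x. x\<^sup>2)" "(\<integral>x. x\<^sup>2 \<partial>M) = 1"
    using mean var by (auto simp: has_bochner_integral_iff)
  define w where "w u = (\<integral>x. min (6 * x\<^sup>2) (\<bar>u\<bar> * \<bar>x\<bar> ^ 3) \<partial>M)" for u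
  have approx: "cmod (char M u - (1 - u\<^sup>2 / 2)) \<le> u\<^sup>2 / 6 * w u" for u
    using char_approx3[OF int1 int2(1), of 1 u] int1 int2 by (simp add: w_def)
  have min_int: "integrable M (\<lambda>x. min (6 * x\<^sup>2) (\<bar>u\<bar> * \<bar>x\<bar> ^ 3))" for u
    by (rule Bochner_Integration.integrable_bound[OF integrable_mult_right[OF int2(1), of 6]]) auto
  have "w u \<le> (\<integral>x. 6 * x\<^sup>2 \<partial>M)" for u
    unfolding w_def using int2 min_int by (intro integral_mono) auto
  then have w6: "w u \<le> 6" for u using int2 by simp
  show "cmod (1 - char M u) \<le> 2 * u\<^sup>2"
  proof -
    have "cmod (char M u - (1 - u\<^sup>2 / 2)) \<le> u\<^sup>2 / 6 * 6"
      using approx[of u] mult_left_mono[OF w6[of u], of "u\<^sup>2 / 6"] by simp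
    moreover have "cmod (complex_of_real (u\<^sup>2 / 2)) = u\<^sup>2 / 2"
      by (simp only: norm_of_real) simp
    moreover have "cmod (1 - char M u) \<le> cmod (complex_of_real (u\<^sup>2 / 2)) + cmod (char M u - (1 - u\<^sup>2 / 2))"
      using norm_triangle_ineq4[of "complex_of_real (u\<^sup>2 / 2)" "char M u - (1 - u\<^sup>2 / 2)"] by simp
    ultimately show ?thesis using zero_le_power2[of u] by linarith
  qed
  have "((\<lambda>b. \<integral>y. y\<^sup>2 * indicator {y. \<bar>y\<bar> > 1 * b} y \<partial>M) \<longlongrightarrow> 0) at_top"
    by (rule truncated_second_moment_tendsto_0[OF events_eq_borel int2(1)]) simp
  then have "eventually (\<lambda>b. (\<integral>y. y\<^sup>2 * indicator {y. \<bar>y\<bar> > 1 * b} y \<partial>M) < 1 / 12) at_top"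
    by (rule order_tendstoD) simp
  moreover have "eventually (\<lambda>b::real. 0 < b) at_top" by (rule eventually_gt_at_top)
  ultimately have "eventually (\<lambda>b. (\<integral>y. y\<^sup>2 * indicator {y. \<bar>y\<bar> > 1 * b} y \<partial>M) < 1 / 12 \<and> 0 < b) at_top"
    by eventually_elim simp
  then obtain R where R: "(\<integral>y. y\<^sup>2 * indicator {y. \<bar>y\<bar> > R} y \<partial>M) < 1 / 12" "R > 0"
    by (auto simp: eventually_at_top_linorder)
  show "\<exists>u0>0. \<forall>u. \<bar>u\<bar> \<le> u0 \<longrightarrow> u\<^sup>2 / 3 \<le> Re (1 - char M u)"
  proof (intro exI[of _ "1 / (2 * R)"] conjI allI impI)
    show "0 < 1 / (2 * R)" using R by simp
    fix u assume u: "\<bar>u\<bar> \<le> 1 / (2 * R)"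
    then have uR: "\<bar>u\<bar> * R \<le> 1 / 2" using R by (simp add: field_simps)
    have tr_int: "integrable M (\<lambda>y. y\<^sup>2 * indicator {y. \<bar>y\<bar> > R} y)"
      by (rule Bochner_Integration.integrable_bound[OF int2(1)]) (auto simp: indicator_def)
    have "w u \<le> (\<integral>x. (1 / 2) * x\<^sup>2 + 6 * (x\<^sup>2 * indicator {y. \<bar>y\<bar> > R} x) \<partial>M)"
      unfolding w_def
    proof (rule integral_mono[OF min_int])
      show "integrable M (\<lambda>x. (1 / 2) * x\<^sup>2 + 6 * (x\<^sup>2 * indicator {y. \<bar>y\<bar> > R} x))"
        using int2 tr_int by auto
      fix x
      show "min (6 * x\<^sup>2) (\<bar>u\<bar> * \<bar>x\<bar> ^ 3) \<le> (1 / 2) * x\<^sup>2 + 6 * (x\<^sup>2 * indicator {y. \<bar>y\<bar> > R} x)"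
      proof (cases "\<bar>x\<bar> > R")
        case False
        then have "\<bar>u\<bar> * \<bar>x\<bar> \<le> \<bar>u\<bar> * R" by (intro mult_left_mono) auto
        then have "(\<bar>u\<bar> * \<bar>x\<bar>) * x\<^sup>2 \<le> (1 / 2) * x\<^sup>2"
          using uR by (intro mult_right_mono) auto
        then show ?thesis using False by (simp add: power3_eq_cube power2_eq_square mult.assoc min.coboundedI2)
      qed (intro order_trans[OF min.cobounded1], simp)
    qed
    also have "\<dots> = 1 / 2 + 6 * (\<integral>y. y\<^sup>2 * indicator {y. \<bar>y\<bar> > R} y \<partial>M)"
      using int2 tr_int by simp
    also have "\<dots> \<le> 1" using R by simp
    finally have "cmod (char M u - (1 - u\<^sup>2 / 2)) \<le> u\<^sup>2 / 6"
      using approx[of u] mult_left_mono[of "w u" 1 "u\<^sup>2 / 6"] by simp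
    then have "\<bar>Re (char M u - (1 - u\<^sup>2 / 2))\<bar> \<le> u\<^sup>2 / 6"
      using abs_Re_le_cmod order_trans by blast
    moreover have "Re (char M u - (1 - u\<^sup>2 / 2)) = Re (char M u) - (1 - u\<^sup>2 / 2)"
      by (simp add: Re_power2 Re_divide_numeral)
    ultimately have "u\<^sup>2 / 3 \<le> 1 - Re (char M u)" by linarith
    then show "u\<^sup>2 / 3 \<le> Re (1 - char M u)" by simp
  qed
qed

lemma (in real_distribution) Re_char: "Re (char M u) = (\<integral>x. cos (u * x) \<partial>M)"
proof -
  have "integrable M (\<lambda>x. iexp (u * x))"
    by (intro integrable_const_bound[of _ 1]) auto
  then have "Re (char M u) = (\<integral>x. Re (iexp (u * x)) \<partial>M)" unfolding char_def by simp
  then show ?thesis by (simp add: Re_exp)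
qed

lemma lattice_pred [measurable]: "Measurable.pred borel (\<lambda>x::real. x / h \<in> \<int>)"
proof -
  have Z: "(\<int> :: real set) \<in> sets borel" using closed_Ints by (rule borel_closed)
  show ?thesis using measurable_sets[OF _ Z, of "\<lambda>x. x / h" borel] by (simp add: vimage_def pred_def)
qed

lemma has_lattice_span_distr:
  assumes "X \<in> borel_measurable M"
  shows "has_lattice_span (distr M borel X) (\<lambda>x. x) h \<longleftrightarrow> has_lattice_span M X h"
proof -
  have "(AE x in distr M borel X. x / k \<in> \<int>) \<longleftrightarrow> (AE \<omega> in M. X \<omega> / k \<in> \<int>)" for k
    using assms by (intro AE_distr_iff) auto
  then show ?thesis by (simp add: has_lattice_span_def)
qed

text \<open>
  If \<open>Re \<phi>(u) = 1\<close>, then \<open>u x\<close> is almost surely a multiple of \<open>2 \<pi>\<close>, so the law lives on the lattice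
  of width \<open>2 \<pi> / |u|\<close>. Maximality of \<open>h\<close> forces \<open>|u| \<ge> 2 \<pi> / h\<close>. This is where the span enters.
\<close>

lemma (in real_distribution) char_away_from_one:
  assumes span: "has_lattice_span M (\<lambda>x. x) h" and u: "u \<noteq> 0" "\<bar>u\<bar> \<le> pi / h"
  shows "0 < Re (1 - char M u)"
proof (rule ccontr)
  have h: "h > 0" using span by (simp add: has_lattice_span_def)
  have cos_int: "integrable M (\<lambda>x. cos (u * x))"
    by (intro integrable_const_bound[of _ 1]) auto
  have eq: "Re (1 - char M u) = (\<integral>x. 1 - cos (u * x) \<partial>M)"
    using cos_int by (simp add: Re_char prob_space del: space_eq_univ)
  assume "\<not> 0 < Re (1 - char M u)"
  moreover have "0 \<le> (\<integral>x. 1 - cos (u * x) \<partial>M)" by (rule integral_nonneg_AE) auto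
  ultimately have "(\<integral>x. 1 - cos (u * x) \<partial>M) = 0" using eq by linarith
  then have "AE x in M. 1 - cos (u * x) = 0"
    using cos_int by (subst (asm) integral_nonneg_eq_0_iff_AE) auto
  then have "AE x in M. x / (2 * pi / \<bar>u\<bar>) \<in> \<int>"
  proof (rule AE_mp, intro AE_I2 impI)
    fix x assume "1 - cos (u * x) = 0"
    then obtain n :: int where n: "u * x = real_of_int n * 2 * pi"
      using cos_one_2pi_int[of "u * x"] by auto
    have "x / (2 * pi / \<bar>u\<bar>) = (u * x) * sgn u / (2 * pi)"
      by (cases "u > 0") (use u(1) in \<open>auto simp: sgn_if\<close>)
    also have "\<dots> = real_of_int n * sgn u" unfolding n by simp
    finally show "x / (2 * pi / \<bar>u\<bar>) \<in> \<int>" using u(1) by (auto simp: sgn_if)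
  qed
  then have "2 * pi / \<bar>u\<bar> \<le> h" using span u by (auto simp: has_lattice_span_def)
  then have "2 * pi \<le> h * \<bar>u\<bar>" using u by (simp add: field_simps)
  also have "\<dots> \<le> pi" using u h by (simp add: field_simps)
  finally show False by simp
qed

text \<open>
  Near \<open>0\<close> this is the Taylor bound; elsewhere \<open>Re (1 - \<phi>)\<close> has a positive minimum by compactness.
\<close>

lemma (in real_distribution) char_quadratic_lower_bound:
  assumes mean: "has_bochner_integral M (\<lambda>x. x) 0" and var: "has_bochner_integral M (\<lambda>x. x\<^sup>2) 1"
    and span: "has_lattice_span M (\<lambda>x. x) h"
  obtains c where "0 < c" "c \<le> 1" "\<And>u. \<bar>u\<bar> \<le> pi / h \<Longrightarrow> c * u\<^sup>2 \<le> Re (1 - char M u)"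
proof -
  have h: "h > 0" using span by (simp add: has_lattice_span_def)
  obtain u0 where u0: "u0 > 0" "\<And>u. \<bar>u\<bar> \<le> u0 \<Longrightarrow> u\<^sup>2 / 3 \<le> Re (1 - char M u)"
    using char_quadratic_bounds(2)[OF mean var] by blast
  define K where "K = {- (pi / h)..- u0} \<union> {u0..pi / h}"
  obtain q where q: "q > 0" "\<And>u. u \<in> K \<Longrightarrow> q \<le> Re (1 - char M u)"
  proof (cases "K = {}")
    case True
    then show ?thesis using that[of 1] by simp
  next
    case False
    have "compact K" unfolding K_def by (intro compact_Un) auto
    moreover have "continuous_on K (\<lambda>u. Re (1 - char M u))"
      by (intro continuous_intros continuous_at_imp_continuous_on ballI isCont_char)
    ultimately obtain u1 where u1: "u1 \<in> K" "\<And>u. u \<in> K \<Longrightarrow> Re (1 - char M u1) \<le> Re (1 - char M u)"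
      using continuous_attains_inf[OF _ False] by metis
    have "0 < Re (1 - char M u1)"
      using u1(1) u0(1) by (intro char_away_from_one[OF span]) (auto simp: K_def)
    then show ?thesis using that u1(2) by blast
  qed
  define c where "c = min (1 / 3) (q / (pi / h)\<^sup>2)"
  have r: "0 < (pi / h)\<^sup>2" using h by simp
  show ?thesis
  proof (rule that)
    show "0 < c" "c \<le> 1" using q(1) r by (auto simp: c_def)
    fix u assume u: "\<bar>u\<bar> \<le> pi / h"
    show "c * u\<^sup>2 \<le> Re (1 - char M u)"
    proof (cases "\<bar>u\<bar> \<le> u0")
      case True
      have "c \<le> 1 / 3" unfolding c_def by (rule min.cobounded1)
      then have "c * u\<^sup>2 \<le> 1 / 3 * u\<^sup>2" by (intro mult_right_mono) auto
      then show ?thesis using u0(2)[OF True] by simp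
    next
      case False
      then have "u \<in> K" using u by (auto simp: K_def)
      have "c * u\<^sup>2 \<le> q / (pi / h)\<^sup>2 * (pi / h)\<^sup>2"
        using u q(1) h power_mono[OF u, of 2] by (intro mult_mono) (auto simp: c_def)
      also have "\<dots> = q" using r by simp
      finally show ?thesis using q(2)[OF \<open>u \<in> K\<close>] by simp
    qed
  qed
qed

lemma integral_inverse_quadratic_le:
  fixes r s :: real
  assumes "0 \<le> r" "0 < s"
  shows "(\<integral>u. 1 / (s\<^sup>2 + u\<^sup>2) \<partial>restrict_space lborel {-r..r}) \<le> pi / s"
proof -
  have deriv: "((\<lambda>u. arctan (u / s) / s) has_real_derivative 1 / (s\<^sup>2 + u\<^sup>2)) (at u)" for u
  proof -
    have "((\<lambda>u. arctan (u / s) / s) has_real_derivative inverse (1 + (u / s)\<^sup>2) * (1 / s) / s) (at u)"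
      using assms by (auto intro!: derivative_eq_intros)
    moreover have "1 + (u / s)\<^sup>2 = (s\<^sup>2 + u\<^sup>2) / s\<^sup>2"
      using assms by (simp add: power_divide add_divide_distrib)
    ultimately show ?thesis using assms by (simp add: power2_eq_square)
  qed
  have nz: "s\<^sup>2 + u\<^sup>2 \<noteq> 0" for u
    using assms by (metis add_pos_nonneg less_irrefl zero_le_power2 zero_less_power)
  have "(\<integral>u. 1 / (s\<^sup>2 + u\<^sup>2) \<partial>restrict_space lborel {-r..r}) = (\<integral>u. 1 / (s\<^sup>2 + u\<^sup>2) * indicator {-r..r} u \<partial>lborel)"
    by (subst integral_restrict_space) (auto simp: mult.commute)
  also have "\<dots> = arctan (r / s) / s - arctan (- r / s) / s"
    using assms by (intro integral_FTC_Icc_real deriv) (auto intro!: continuous_intros simp: nz)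
  also have "\<dots> = 2 * arctan (r / s) / s" using assms by (simp add: arctan_minus)
  also have "\<dots> \<le> pi / s"
    using arctan_ubound[of "r / s"] assms by (intro divide_right_mono) auto
  finally show ?thesis .
qed

text \<open>
  Distinct lattice points are orthogonal over one period of frequencies; this produces the point
  mass in the equation of the Green's function.
\<close>

lemma integral_cos_lattice_frequency:
  assumes "r > 0" "y \<noteq> 0" "y * r / pi \<in> \<int>"
  shows "(\<integral>u. cos (y * u) \<partial>restrict_space lborel {-r..r}) = 0"
proof -
  have "(\<integral>u. cos (y * u) \<partial>restrict_space lborel {-r..r}) = (\<integral>u. cos (y * u) * indicator {-r..r} u \<partial>lborel)"
    by (subst integral_restrict_space) (auto simp: mult.commute)
  also have "\<dots> = sin (y * r) / y - sin (y * - r) / y"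
    using assms by (intro integral_FTC_Icc_real)
      (auto intro!: derivative_eq_intros continuous_intros)
  also have "sin (y * r) = 0"
  proof -
    obtain k :: int where "y * r / pi = real_of_int k" using assms(3) by (auto elim: Ints_cases)
    then have "y * r = real_of_int k * pi" by (simp add: field_simps)
    then show ?thesis by (simp add: sin_zero_iff_int2)
  qed
  finally show ?thesis using \<open>sin (y * r) = 0\<close> by simp
qed

text \<open>
  A version of \<open>min (2, |t|)\<close> chosen so that, against \<open>1 / (l + u\<^sup>2)\<close> with \<open>t = y u\<close>, both summands
  lead to integrals of the form \<open>\<integral> 1 / (s\<^sup>2 + u\<^sup>2)\<close>.
\<close>

lemma cmod_cis_minus_one_bound:
  assumes "\<eta> > 0"
  shows "cmod (cis t - 1) \<le> \<eta> + 4 * t\<^sup>2 / (t\<^sup>2 + \<eta>\<^sup>2)"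
proof (cases "\<bar>t\<bar> \<le> \<eta>")
  case True
  have "cmod (cis t - 1) \<le> \<bar>t\<bar>"
    using iexp_approx1[of t 0] by (simp add: cis_conv_exp)
  moreover have "0 \<le> 4 * t\<^sup>2 / (t\<^sup>2 + \<eta>\<^sup>2)" by simp
  ultimately show ?thesis using True by linarith
next
  case False
  have "cmod (cis t - 1) \<le> 2" using norm_triangle_ineq4[of "cis t" 1] by simp
  moreover have "\<eta>\<^sup>2 \<le> t\<^sup>2" using False assms by (simp add: abs_le_square_iff[symmetric])
  then have "2 \<le> 4 * t\<^sup>2 / (t\<^sup>2 + \<eta>\<^sup>2)"
    using assms by (subst le_divide_eq) (auto simp: add_nonneg_pos)
  ultimately show ?thesis using assms by linarith
qed

section \<open>The discounted Green's function of a lattice walk\<close>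

text \<open>
  The two bounds say that \<open>1 - e\<^sup>-\<^sup>l \<phi>(u)\<close> is of exact order \<open>l + u\<^sup>2\<close>. The constant \<open>\<kappa>\<close> is to be
  independent of \<open>l\<close>, since \<open>l\<close> tends to \<open>0\<close> in the end.
\<close>

locale lattice_green = real_distribution \<mu> for \<mu> :: "real measure" +
  fixes h l \<kappa> :: real
  assumes h: "0 < h" and l: "0 < l" and \<kappa>: "0 < \<kappa>"
    and Re_lower: "\<And>u. \<bar>u\<bar> \<le> pi / h \<Longrightarrow> \<kappa> * (l + u\<^sup>2) \<le> Re (1 - exp (- l) * char \<mu> u)"
    and cmod_upper: "\<And>u. cmod (1 - exp (- l) * char \<mu> u) \<le> 2 * (l + u\<^sup>2)"
    and on_lattice: "AE x in \<mu>. x / h \<in> \<int>"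
begin

definition resolvent :: "real \<Rightarrow> complex" where
  "resolvent u = 1 / (1 - exp (- l) * char \<mu> u)"

definition frequencies :: "real measure" where
  "frequencies = restrict_space lborel {- (pi / h)..pi / h}"

definition mode :: "real \<Rightarrow> real \<Rightarrow> real" where
  "mode y u = Re (cis (- (y * u)) * resolvent u)"

text \<open>
  Up to the factor \<open>2 \<pi> / h\<close> this is \<open>\<Sum>\<^sub>t e\<^sup>-\<^sup>l\<^sup>t P(S\<^sub>t = y)\<close>, summed under the Fourier inversion
  integral. The constant cancels in the quotients formed later.
\<close>

definition green :: "real \<Rightarrow> real" where
  "green y = (\<integral>u. mode y u \<partial>frequencies)"

text \<open>
  The yardstick for all estimates: \<open>G(0)\<close> is comparable to it, and no value of \<open>G\<close> is larger in
  order of magnitude.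
\<close>

definition mass :: real where
  "mass = (\<integral>u. 1 / (l + u\<^sup>2) \<partial>frequencies)"

lemma space_frequencies: "u \<in> space frequencies \<longleftrightarrow> \<bar>u\<bar> \<le> pi / h"
  by (auto simp: frequencies_def space_restrict_space abs_le_iff)

lemma finite_measure_frequencies: "finite_measure frequencies"
  by (rule finite_measureI)
     (simp add: frequencies_def emeasure_restrict_space space_restrict_space emeasure_lborel_Icc_eq)

lemma frequencies_measurable: "f \<in> borel_measurable borel \<Longrightarrow> f \<in> borel_measurable frequencies"
  unfolding frequencies_def by (intro measurable_restrict_space1) simp

lemma resolvent_measurable [measurable]: "resolvent \<in> borel_measurable borel"
  unfolding resolvent_def[abs_def] by measurable

lemma quadratic_pos: "0 < l + u\<^sup>2" using l by (simp add: add_pos_nonneg)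

lemma cmod_resolvent_le:
  assumes "\<bar>u\<bar> \<le> pi / h"
  shows "cmod (resolvent u) \<le> 1 / \<kappa> * (1 / (l + u\<^sup>2))"
proof -
  have "\<kappa> * (l + u\<^sup>2) \<le> cmod (1 - exp (- l) * char \<mu> u)"
    using Re_lower[OF assms] complex_Re_le_cmod order_trans by blast
  then have "1 / cmod (1 - exp (- l) * char \<mu> u) \<le> 1 / (\<kappa> * (l + u\<^sup>2))"
    using mult_pos_pos[OF \<kappa> quadratic_pos[of u]] by (intro frac_le) auto
  then show ?thesis by (simp add: resolvent_def norm_divide)
qed

lemma Re_resolvent_ge:
  assumes "\<bar>u\<bar> \<le> pi / h"
  shows "\<kappa> / 4 * (1 / (l + u\<^sup>2)) \<le> Re (resolvent u)"
proof -
  define z where "z = 1 - exp (- l) * char \<mu> u"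
  define q where "q = l + u\<^sup>2"
  have q: "0 < q" unfolding q_def by (rule quadratic_pos)
  have Re: "\<kappa> * q \<le> Re z" unfolding z_def q_def by (rule Re_lower[OF assms])
  moreover have "0 < \<kappa> * q" using \<kappa> q by simp
  ultimately have Re0: "0 < Re z" by linarith
  then have z: "0 < cmod z" using complex_Re_le_cmod[of z] by linarith
  have "(cmod z)\<^sup>2 \<le> (2 * q)\<^sup>2" unfolding z_def q_def by (intro power_mono cmod_upper) simp
  then have "\<kappa> / 4 * (1 / q) * (cmod z)\<^sup>2 \<le> \<kappa> / 4 * (1 / q) * (2 * q)\<^sup>2"
    using \<kappa> q by (intro mult_left_mono) auto
  also have "\<dots> = \<kappa> * q" using q by (simp add: power2_eq_square)
  also have "\<dots> \<le> Re z" by (rule Re)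
  finally have "\<kappa> / 4 * (1 / q) \<le> Re z / (cmod z)\<^sup>2" using z by (subst pos_le_divide_eq) auto
  also have "Re z / (cmod z)\<^sup>2 = Re (1 / z)"
    by (simp add: Re_divide cmod_power2)
  finally show ?thesis by (simp add: resolvent_def z_def q_def)
qed

lemma frequencies_integrable:
  fixes f :: "real \<Rightarrow> 'c::{banach, second_countable_topology}"
  assumes "f \<in> borel_measurable borel" "\<And>u. \<bar>u\<bar> \<le> pi / h \<Longrightarrow> norm (f u) \<le> B"
  shows "integrable frequencies f"
proof -
  interpret F: finite_measure frequencies by (rule finite_measure_frequencies)
  show ?thesis
    using assms(2) by (intro F.integrable_const_bound[where B=B] AE_I2 frequencies_measurable assms(1))
      (auto simp: space_frequencies)
qed

lemma inverse_quadratic_bound: "norm (1 / (l + u\<^sup>2)) \<le> 1 / l"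
  using l quadratic_pos[of u] by (auto intro: divide_left_mono)

lemma mass_integrable: "integrable frequencies (\<lambda>u. 1 / (l + u\<^sup>2))"
  by (rule frequencies_integrable[where B="1 / l"]) (simp, rule inverse_quadratic_bound)

lemma cmod_resolvent_bound: "\<bar>u\<bar> \<le> pi / h \<Longrightarrow> cmod (resolvent u) \<le> 1 / (\<kappa> * l)"
  using order_trans[OF cmod_resolvent_le mult_left_mono[OF inverse_quadratic_bound[of u], of "1/\<kappa>", simplified real_norm_def abs_of_pos[OF divide_pos_pos[OF zero_less_one quadratic_pos]]]] \<kappa>
  by simp

lemma abs_mode_le: "\<bar>mode y u\<bar> \<le> cmod (resolvent u)"
  using abs_Re_le_cmod[of "cis (- (y * u)) * resolvent u"] by (simp add: mode_def norm_mult)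

lemma abs_mode_bound: "\<bar>u\<bar> \<le> pi / h \<Longrightarrow> \<bar>mode y u\<bar> \<le> 1 / (\<kappa> * l)"
  by (rule order_trans[OF abs_mode_le cmod_resolvent_bound])

lemma mode_measurable [measurable]:
  "(\<lambda>(y, u). mode y u) \<in> borel_measurable (borel \<Otimes>\<^sub>M borel)"
  unfolding mode_def cis_conv_exp by measurable

lemma mode_measurable2 [measurable]: "mode y \<in> borel_measurable borel"
  unfolding mode_def[abs_def] cis_conv_exp by measurable

lemma green_integrable: "integrable frequencies (mode y)"
  by (rule frequencies_integrable[where B="1 / (\<kappa> * l)"]) (simp_all add: abs_mode_bound del: zero_less_mult_iff)

text \<open>
  On \<open>|u| \<le> \<surd>l\<close> the integrand is at least \<open>1 / (2 l)\<close>.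
\<close>

lemma mass_ge:
  assumes "sqrt l \<le> pi / h"
  shows "1 / sqrt l \<le> mass"
proof -
  have int: "integrable frequencies (\<lambda>u. 1 / (2 * l) * indicator {- sqrt l..sqrt l} u)"
    by (rule frequencies_integrable[where B="1 / (2 * l)"]) (use l in \<open>auto simp: indicator_def\<close>)
  have "1 / sqrt l = 1 / (2 * l) * (2 * sqrt l)"
    using l by (simp add: field_simps real_sqrt_mult_self)
  also have "\<dots> = (\<integral>u. 1 / (2 * l) * indicator {- sqrt l..sqrt l} u \<partial>lborel)"
    using l by simp
  also have "\<dots> = (\<integral>u. 1 / (2 * l) * indicator {- sqrt l..sqrt l} u \<partial>frequencies)"
    unfolding frequencies_def using assms
    by (subst integral_restrict_space) (auto simp: indicator_def intro!: Bochner_Integration.integral_cong)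
  also have "\<dots> \<le> mass"
    unfolding mass_def
  proof (rule integral_mono[OF int mass_integrable])
    fix u
    show "1 / (2 * l) * indicator {- sqrt l..sqrt l} u \<le> 1 / (l + u\<^sup>2)"
    proof (cases "u \<in> {- sqrt l..sqrt l}")
      case True
      then have "\<bar>u\<bar> \<le> sqrt l" by auto
      then have "u\<^sup>2 \<le> l" using l by (metis abs_le_square_iff abs_of_nonneg real_sqrt_ge_zero real_sqrt_pow2 less_imp_le)
      then show ?thesis using True l quadratic_pos[of u] by (auto intro: divide_left_mono)
    qed (use quadratic_pos[of u] in auto)
  qed
  finally show ?thesis .
qed

lemma green_0_ge: "\<kappa> / 4 * mass \<le> green 0"
proof -
  have "\<kappa> / 4 * mass = (\<integral>u. \<kappa> / 4 * (1 / (l + u\<^sup>2)) \<partial>frequencies)"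
    unfolding mass_def by (rule Bochner_Integration.integral_mult_right_zero[symmetric])
  also have "\<dots> \<le> (\<integral>u. mode 0 u \<partial>frequencies)"
  proof (rule integral_mono[OF integrable_mult_right[OF mass_integrable] green_integrable])
    fix u assume "u \<in> space frequencies"
    then show "\<kappa> / 4 * (1 / (l + u\<^sup>2)) \<le> mode 0 u"
      using Re_resolvent_ge[of u] by (simp only: space_frequencies mode_def) simp
  qed
  finally show ?thesis by (simp add: green_def)
qed

lemma abs_green_le: "\<bar>green y\<bar> \<le> 1 / \<kappa> * mass"
proof -
  have "\<bar>green y\<bar> \<le> (\<integral>u. \<bar>mode y u\<bar> \<partial>frequencies)"
    unfolding green_def by (rule integral_abs_bound)
  also have "\<dots> \<le> (\<integral>u. 1 / \<kappa> * (1 / (l + u\<^sup>2)) \<partial>frequencies)"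
    by (rule integral_mono[OF integrable_abs[OF green_integrable] integrable_mult_right[OF mass_integrable]])
       (unfold space_frequencies, rule order_trans[OF abs_mode_le cmod_resolvent_le])
  also have "\<dots> = 1 / \<kappa> * mass"
    unfolding mass_def by (rule Bochner_Integration.integral_mult_right_zero)
  finally show ?thesis .
qed

text \<open>
  The frequencies with \<open>|y u| \<le> \<eta>\<close> change \<open>G\<close> by at most a multiple of \<open>\<eta>\<close> times the mass. The
  remaining ones contribute at most the order \<open>\<integral> 1 / u\<^sup>2\<close> over \<open>|u| \<ge> \<eta> / |y|\<close>, that is \<open>|y| / \<eta>\<close>.
\<close>

lemma green_increment_le:
  assumes y: "y \<noteq> 0" "\<bar>y\<bar> \<le> Y" and \<eta>: "\<eta> > 0"
  shows "\<bar>green y - green 0\<bar> \<le> 1 / \<kappa> * (\<eta> * mass + 4 * pi * Y / \<eta>)"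
proof -
  \<comment> \<open>The frequency at which \<open>|y u|\<close> reaches \<open>\<eta>\<close>.\<close>
  define s where "s = \<eta> / \<bar>y\<bar>"
  have s: "s > 0" using y \<eta> by (simp add: s_def)
  have s_pos: "0 < s\<^sup>2 + u\<^sup>2" for u using s by (simp add: add_pos_nonneg)
  have s_int: "integrable frequencies (\<lambda>u. 1 / (s\<^sup>2 + u\<^sup>2))"
  proof (rule frequencies_integrable[where B="1 / s\<^sup>2"])
    show "norm (1 / (s\<^sup>2 + u\<^sup>2)) \<le> 1 / s\<^sup>2" for u
      using s s_pos[of u] by (auto intro: divide_left_mono)
  qed simp
  have point: "\<bar>mode y u - mode 0 u\<bar>
      \<le> 1 / \<kappa> * (\<eta> * (1 / (l + u\<^sup>2)) + 4 * (1 / (s\<^sup>2 + u\<^sup>2)))" if u: "\<bar>u\<bar> \<le> pi / h" for u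
  proof -
    define q where "q = l + u\<^sup>2"
    have q: "0 < q" "u\<^sup>2 \<le> q" using l by (auto simp: q_def quadratic_pos)
    have "mode y u - mode 0 u = Re ((cis (- (y * u)) - 1) * resolvent u)"
      by (simp add: mode_def algebra_simps)
    also have "\<bar>\<dots>\<bar> \<le> cmod (cis (- (y * u)) - 1) * cmod (resolvent u)"
      using abs_Re_le_cmod[of "(cis (- (y * u)) - 1) * resolvent u"] by (simp add: norm_mult)
    also have "\<dots> \<le> (\<eta> + 4 * (y * u)\<^sup>2 / ((y * u)\<^sup>2 + \<eta>\<^sup>2)) * (1 / \<kappa> * (1 / q))"
      using cmod_cis_minus_one_bound[OF \<eta>, of "- (y * u)"] cmod_resolvent_le[OF u] \<eta>
      by (intro mult_mono) (auto simp: q_def)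
    also have "4 * (y * u)\<^sup>2 / ((y * u)\<^sup>2 + \<eta>\<^sup>2) = 4 * (u\<^sup>2 * (1 / (s\<^sup>2 + u\<^sup>2)))"
    proof -
      have "(y * u)\<^sup>2 + \<eta>\<^sup>2 = y\<^sup>2 * (s\<^sup>2 + u\<^sup>2)"
        using y by (simp add: s_def field_simps power2_eq_square)
      then show ?thesis using y by (simp add: power_mult_distrib)
    qed
    also have "(\<eta> + 4 * (u\<^sup>2 * (1 / (s\<^sup>2 + u\<^sup>2)))) * (1 / \<kappa> * (1 / q))
        = 1 / \<kappa> * (\<eta> * (1 / q) + 4 * (u\<^sup>2 / q) * (1 / (s\<^sup>2 + u\<^sup>2)))"
    proof -
      have "(\<eta> + 4 * (u\<^sup>2 * w)) * (1 / \<kappa> * (1 / q)) = 1 / \<kappa> * (\<eta> * (1 / q) + 4 * (u\<^sup>2 / q) * w)" for w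
        by (simp add: add_divide_distrib distrib_right mult_ac)
      then show ?thesis by blast
    qed
    also have "\<dots> \<le> 1 / \<kappa> * (\<eta> * (1 / q) + 4 * 1 * (1 / (s\<^sup>2 + u\<^sup>2)))"
      using q \<kappa> s_pos[of u] by (intro mult_left_mono add_left_mono mult_right_mono) auto
    finally show ?thesis by (simp add: q_def)
  qed
  have "green y - green 0 = (\<integral>u. mode y u - mode 0 u \<partial>frequencies)"
    unfolding green_def using green_integrable[of y] green_integrable[of 0] by simp
  also have "\<bar>\<dots>\<bar> \<le> (\<integral>u. \<bar>mode y u - mode 0 u\<bar> \<partial>frequencies)"
    by (rule integral_abs_bound)
  also have "\<dots> \<le> (\<integral>u. 1 / \<kappa> * (\<eta> * (1 / (l + u\<^sup>2)) + 4 * (1 / (s\<^sup>2 + u\<^sup>2))) \<partial>frequencies)"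
  proof (rule integral_mono)
    show "integrable frequencies (\<lambda>u. \<bar>mode y u - mode 0 u\<bar>)"
      by (intro integrable_abs Bochner_Integration.integrable_diff green_integrable)
    show "integrable frequencies (\<lambda>u. 1 / \<kappa> * (\<eta> * (1 / (l + u\<^sup>2)) + 4 * (1 / (s\<^sup>2 + u\<^sup>2))))"
      by (intro integrable_mult_right Bochner_Integration.integrable_add mass_integrable s_int)
  qed (rule point, simp only: space_frequencies)
  also have "\<dots> = 1 / \<kappa> * (\<eta> * mass + 4 * (\<integral>u. 1 / (s\<^sup>2 + u\<^sup>2) \<partial>frequencies))"
    unfolding mass_def
    by (simp only: Bochner_Integration.integral_mult_right_zero Bochner_Integration.integral_add
        integrable_mult_right mass_integrable s_int)
  also have "\<dots> \<le> 1 / \<kappa> * (\<eta> * mass + 4 * (pi / s))"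
    using integral_inverse_quadratic_le[OF _ s, of "pi / h"] h \<kappa>
    by (intro mult_left_mono add_left_mono) (auto simp: frequencies_def)
  also have "pi / s = pi * \<bar>y\<bar> / \<eta>" by (simp add: s_def)
  also have "1 / \<kappa> * (\<eta> * mass + 4 * (pi * \<bar>y\<bar> / \<eta>)) \<le> 1 / \<kappa> * (\<eta> * mass + 4 * (pi * Y / \<eta>))"
    using y \<kappa> \<eta> by (intro mult_left_mono add_left_mono divide_right_mono) auto
  finally show ?thesis by (simp add: mult.assoc)
qed

lemma frequencies_to_borel: "(\<lambda>u. u) \<in> measurable frequencies borel"
  by (rule frequencies_measurable) simp

lemma green_measurable [measurable]: "green \<in> borel_measurable borel"
proof -
  interpret F: finite_measure frequencies by (rule finite_measure_frequencies)
  have "(\<lambda>p. (fst p, snd p)) \<in> measurable (borel \<Otimes>\<^sub>M frequencies) (borel \<Otimes>\<^sub>M borel :: (real \<times> real) measure)"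
    by (intro measurable_Pair measurable_fst measurable_compose[OF measurable_snd frequencies_to_borel])
  from measurable_compose[OF this mode_measurable]
  have "(\<lambda>(y, u). mode y u) \<in> borel_measurable (borel \<Otimes>\<^sub>M frequencies)" by (simp add: case_prod_beta)
  then show ?thesis unfolding green_def[abs_def] by (rule F.borel_measurable_lebesgue_integral)
qed

text \<open>
  Averaging over a step multiplies the mode of frequency \<open>u\<close> by \<open>\<phi>(u)\<close>, and
  \<open>e\<^sup>-\<^sup>l \<phi> / (1 - e\<^sup>-\<^sup>l \<phi>) = 1 / (1 - e\<^sup>-\<^sup>l \<phi>) - 1\<close>. The last term integrates to the point mass
  at \<open>0\<close>, which is not seen at \<open>y \<noteq> 0\<close>.
\<close>

lemma green_harmonic:
  assumes y: "y \<noteq> 0" "y / h \<in> \<int>"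
  shows "exp (- l) * (\<integral>x. green (y - x) \<partial>\<mu>) = green y"
proof -
  interpret F: finite_measure frequencies by (rule finite_measure_frequencies)
  interpret P: pair_sigma_finite \<mu> frequencies ..
  interpret PF: finite_measure "\<mu> \<Otimes>\<^sub>M frequencies"
    by (intro finite_measure_pair_measure) unfold_locales
  have char_int: "integrable \<mu> (\<lambda>x. cis (x * u))" for u
    by (intro integrable_const_bound[of _ 1]) (auto simp: cis_conv_exp)
  have char_cis: "char \<mu> u = (\<integral>x. cis (x * u) \<partial>\<mu>)" for u
    by (simp add: char_def cis_conv_exp mult.commute)
  have inner: "exp (- l) * (\<integral>x. mode (y - x) u \<partial>\<mu>) = mode y u - cos (y * u)" if u: "\<bar>u\<bar> \<le> pi / h" for u
  proof -
    have split: "mode (y - x) u = Re (cis (- (y * u)) * resolvent u * cis (x * u))" for x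
    proof -
      have "cis (- ((y - x) * u)) = cis (- (y * u)) * cis (x * u)"
        by (simp add: cis_mult algebra_simps)
      then show ?thesis unfolding mode_def by (simp only: mult_ac)
    qed
    have "(\<integral>x. mode (y - x) u \<partial>\<mu>) = Re (\<integral>x. cis (- (y * u)) * resolvent u * cis (x * u) \<partial>\<mu>)"
      unfolding split by (rule integral_Re) (intro integrable_mult_right char_int)
    also have "\<dots> = Re (cis (- (y * u)) * resolvent u * char \<mu> u)"
      unfolding char_cis by (subst Bochner_Integration.integral_mult_right_zero) (rule refl)
    finally have "exp (- l) * (\<integral>x. mode (y - x) u \<partial>\<mu>)
        = Re (complex_of_real (exp (- l)) * (cis (- (y * u)) * resolvent u * char \<mu> u))"
      by (simp only: Re_complex_of_real Im_complex_of_real times_complex.sel mult_zero_left diff_zero)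
    also have "complex_of_real (exp (- l)) * (cis (- (y * u)) * resolvent u * char \<mu> u)
        = cis (- (y * u)) * (resolvent u * (exp (- l) * char \<mu> u))"
      by (simp only: mult_ac)
    also have "resolvent u * (exp (- l) * char \<mu> u) = resolvent u - 1"
    proof -
      have "0 < Re (1 - exp (- l) * char \<mu> u)"
        using Re_lower[OF u] mult_pos_pos[OF \<kappa> quadratic_pos[of u]] by linarith
      then have nz: "1 - exp (- l) * char \<mu> u \<noteq> 0" by (metis less_irrefl zero_complex.sel(1))
      have "resolvent u * (exp (- l) * char \<mu> u) - resolvent u
          = - (resolvent u * (1 - exp (- l) * char \<mu> u))" by (simp only: right_diff_distrib) simp
      also have "\<dots> = - 1" using nz by (simp add: resolvent_def)
      finally show ?thesis by (simp add: diff_eq_eq)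
    qed
    finally show ?thesis by (simp add: mode_def right_diff_distrib)
  qed
  have pair_meas: "(\<lambda>(x, u). mode (y - x) u) \<in> borel_measurable (\<mu> \<Otimes>\<^sub>M frequencies)"
  proof -
    have "(\<lambda>p. (y - fst p, snd p)) \<in> measurable (\<mu> \<Otimes>\<^sub>M frequencies) (borel \<Otimes>\<^sub>M borel :: (real \<times> real) measure)"
      by (intro measurable_Pair measurable_compose[OF measurable_snd frequencies_to_borel]) measurable
    from measurable_compose[OF this mode_measurable] show ?thesis by (simp add: case_prod_beta)
  qed
  have "(\<integral>x. green (y - x) \<partial>\<mu>) = (\<integral>u. (\<integral>x. mode (y - x) u \<partial>\<mu>) \<partial>frequencies)"
    unfolding green_def
  proof (rule P.Fubini_integral[symmetric], rule PF.integrable_const_bound[where B="1 / (\<kappa> * l)"])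
    show "AE p in \<mu> \<Otimes>\<^sub>M frequencies. norm (case p of (x, u) \<Rightarrow> mode (y - x) u) \<le> 1 / (\<kappa> * l)"
    proof (rule AE_I2)
      fix p assume "p \<in> space (\<mu> \<Otimes>\<^sub>M frequencies)"
      then have "\<bar>snd p\<bar> \<le> pi / h" by (auto simp: space_pair_measure space_frequencies)
      from abs_mode_bound[OF this, of "y - fst p"]
      show "norm (case p of (x, u) \<Rightarrow> mode (y - x) u) \<le> 1 / (\<kappa> * l)" by (simp add: case_prod_beta)
    qed
  qed (rule pair_meas)
  then have "exp (- l) * (\<integral>x. green (y - x) \<partial>\<mu>) = (\<integral>u. exp (- l) * (\<integral>x. mode (y - x) u \<partial>\<mu>) \<partial>frequencies)"
    by simp
  also have "\<dots> = (\<integral>u. mode y u - cos (y * u) \<partial>frequencies)"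
    by (rule Bochner_Integration.integral_cong) (auto simp: space_frequencies inner)
  also have "\<dots> = green y - (\<integral>u. cos (y * u) \<partial>frequencies)"
    unfolding green_def
    by (rule Bochner_Integration.integral_diff[OF green_integrable])
       (rule frequencies_integrable[where B=1], auto)
  also have "(\<integral>u. cos (y * u) \<partial>frequencies) = 0"
    unfolding frequencies_def using h y by (intro integral_cos_lattice_frequency) auto
  finally show ?thesis by simp
qed

end

section \<open>Hitting a lattice point\<close>

context walk_with_law
begin

lemma discounted_hit_measurable:
  assumes "A \<in> sets borel" "l > 0"
  shows "(\<lambda>\<omega>. exp_neg (ereal l * walk_hitting_time (random_walk \<xi>) A \<omega>)) \<in> borel_measurable M"
  using exit_value_measurable[of "\<lambda>_. 1" "- A" 1 l] assms
  by (simp add: exp_neg_walk_hitting_time_eq_exit_value[of l _ "- A", simplified])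

lemma walk_on_lattice:
  assumes "AE x in \<mu>. x / h \<in> \<int>"
  shows "AE \<omega> in M. \<forall>t. random_walk \<xi> t \<omega> / h \<in> \<int>"
  unfolding AE_all_countable
proof
  fix t
  show "AE \<omega> in M. random_walk \<xi> t \<omega> / h \<in> \<int>"
  proof (induction t)
    case (Suc t)
    have "distr M borel (\<xi> (Suc t)) = \<mu>" by (rule law) simp
    then have "AE x in distr M borel (\<xi> (Suc t)). x / h \<in> \<int>"
      using assms by (rule ssubst[where P="\<lambda>\<nu>. AE x in \<nu>. x / h \<in> \<int>"])
    from AE_distrD[OF steps_measurable this]
    have "AE \<omega> in M. \<xi> (Suc t) \<omega> / h \<in> \<int>" by simp
    with Suc show ?case by eventually_elim (simp add: add_divide_distrib)
  qed simp
qed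

text \<open>
  The walk almost surely stays on the lattice, so off the lattice the target may be changed at will.
  In the applications the complement of the lattice is added to it, where \<open>v\<close> can be set to \<open>1\<close>.
\<close>

lemma discounted_hit_cong_lattice:
  assumes lattice: "AE x in \<mu>. x / h \<in> \<int>" and l: "l > 0"
    and A: "A \<in> sets borel" "B \<in> sets borel" and AB: "\<And>x. x / h \<in> \<int> \<Longrightarrow> x \<in> A \<longleftrightarrow> x \<in> B"
  shows "(\<integral>\<omega>. exp_neg (ereal l * walk_hitting_time (random_walk \<xi>) A \<omega>) \<partial>M)
    = (\<integral>\<omega>. exp_neg (ereal l * walk_hitting_time (random_walk \<xi>) B \<omega>) \<partial>M)"
proof (rule integral_cong_AE)
  show "AE \<omega> in M. exp_neg (ereal l * walk_hitting_time (random_walk \<xi>) A \<omega>)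
      = exp_neg (ereal l * walk_hitting_time (random_walk \<xi>) B \<omega>)"
    using walk_on_lattice[OF lattice] by eventually_elim (simp add: walk_hitting_time_def AB)
qed (intro discounted_hit_measurable A l)+

end

context lattice_green
begin

definition green_ratio :: "real \<Rightarrow> real" where
  "green_ratio y = green y / green 0"

lemma green_ratio_measurable [measurable]: "green_ratio \<in> borel_measurable borel"
  unfolding green_ratio_def[abs_def] by measurable

context
  assumes low_rate: "sqrt l \<le> pi / h"
begin

lemma mass_pos: "0 < mass"
  using mass_ge[OF low_rate] l by (meson less_le_trans real_sqrt_gt_0_iff zero_less_divide_1_iff)

lemma green_0_pos: "0 < green 0"
  using green_0_ge mult_pos_pos[OF divide_pos_pos[OF \<kappa>, of 4] mass_pos] by linarith

lemma green_ratio_0: "green_ratio 0 = 1"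
  using green_0_pos by (simp add: green_ratio_def)

lemma abs_green_ratio_le: "\<bar>green_ratio y\<bar> \<le> 4 / \<kappa>\<^sup>2"
proof -
  have "\<bar>green_ratio y\<bar> = \<bar>green y\<bar> / green 0"
    using green_0_pos by (simp add: green_ratio_def)
  also have "\<dots> \<le> (1 / \<kappa> * mass) / (\<kappa> / 4 * mass)"
    using abs_green_le green_0_ge mass_pos \<kappa> by (intro frac_le) auto
  also have "\<dots> = 4 / \<kappa>\<^sup>2" using mass_pos \<kappa> by (simp add: power2_eq_square)
  finally show ?thesis .
qed

text \<open>
  With \<open>l = \<theta> / b\<^sup>2\<close> and \<open>Y = \<epsilon> b\<close> the bound no longer depends on \<open>b\<close>, because
  \<open>Y \<surd>l = \<epsilon> \<surd>\<theta>\<close>.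
\<close>

lemma green_ratio_near_0:
  assumes Y: "\<bar>y\<bar> \<le> Y" and \<eta>: "\<eta> > 0"
  shows "\<bar>green_ratio y - 1\<bar> \<le> 4 / \<kappa>\<^sup>2 * (\<eta> + 4 * pi * Y * sqrt l / \<eta>)"
proof (cases "y = 0")
  case True
  have "0 \<le> Y" using Y by linarith
  then show ?thesis using True \<eta> l by (simp add: green_ratio_0)
next
  case False
  have Y0: "0 \<le> Y" using Y by linarith
  have inv: "1 / mass \<le> sqrt l"
    using mass_ge[OF low_rate] mass_pos l by (simp add: field_simps)
  have "\<bar>green_ratio y - 1\<bar> = \<bar>green y - green 0\<bar> / green 0"
    using green_0_pos by (simp add: green_ratio_def field_simps)
  also have "\<dots> \<le> (1 / \<kappa> * (\<eta> * mass + 4 * pi * Y / \<eta>)) / (\<kappa> / 4 * mass)"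
    using green_increment_le[OF False Y \<eta>] green_0_ge mass_pos \<kappa> Y0 \<eta> by (intro frac_le) auto
  also have "\<dots> = 4 / \<kappa>\<^sup>2 * (\<eta> + 4 * pi * Y / \<eta> * (1 / mass))"
    using mass_pos \<kappa> \<eta> by (simp add: field_simps power2_eq_square)
  also have "\<dots> \<le> 4 / \<kappa>\<^sup>2 * (\<eta> + 4 * pi * Y / \<eta> * sqrt l)"
    using inv Y0 \<eta> by (intro mult_left_mono add_left_mono) auto
  finally show ?thesis by simp
qed

lemma green_ratio_harmonic:
  assumes "y \<noteq> 0" "y / h \<in> \<int>"
  shows "exp (- l) * (\<integral>x. green_ratio (y - x) \<partial>\<mu>) = green_ratio y"
  unfolding green_ratio_def using green_harmonic[OF assms] by simp

text \<open>
  Optional stopping with both errors equal to \<open>0\<close>.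
\<close>

lemma expectation_point_hit:
  assumes walk: "walk_with_law M \<xi> \<mu>"
    and b: "b / h \<in> \<int>"
  shows "(\<integral>\<omega>. exp_neg (ereal l * walk_hitting_time (random_walk \<xi>) {x. x = b} \<omega>) \<partial>M) = green_ratio b"
proof -
  interpret W: walk_with_law M \<xi> \<mu> by (rule walk)
  define D where "D = {x. x / h \<in> \<int>} - {b}"
  have D[measurable]: "D \<in> sets borel" unfolding D_def by measurable
  define v where "v x = (if x / h \<in> \<int> then green_ratio (b - x) else 1)" for x
  have v_meas[measurable]: "v \<in> borel_measurable borel"
    unfolding v_def by measurable
  have v_bound: "\<bar>v x\<bar> \<le> 4 / \<kappa>\<^sup>2 + 1" for x
    using abs_green_ratio_le[of "b - x"] by (auto simp: v_def)
  have step: "\<bar>exp (- l) * (\<integral>y. v (x + y) \<partial>\<mu>) - v x\<bar> \<le> 0" if "x \<in> D" for x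
  proof -
    have x: "x / h \<in> \<int>" "b - x \<noteq> 0" using that by (auto simp: D_def)
    have "(\<integral>y. v (x + y) \<partial>\<mu>) = (\<integral>y. green_ratio ((b - x) - y) \<partial>\<mu>)"
    proof (rule integral_cong_AE)
      show "AE y in \<mu>. v (x + y) = green_ratio ((b - x) - y)"
        using on_lattice by eventually_elim (use x in \<open>simp add: v_def add_divide_distrib algebra_simps\<close>)
    qed measurable
    moreover have "(b - x) / h \<in> \<int>" using b x by (simp add: diff_divide_distrib)
    ultimately show ?thesis using green_ratio_harmonic[of "b - x"] x by (simp add: v_def)
  qed
  have "\<bar>(\<integral>\<omega>. exp_neg (ereal l * walk_hitting_time (random_walk \<xi>) (- D) \<omega>) \<partial>M) - v 0\<bar>
      \<le> 0 / (1 - exp (- l)) + 0"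
    by (rule W.expectation_discounted_hit[OF v_meas D v_bound l step])
       (auto simp: D_def v_def green_ratio_0)
  then have "(\<integral>\<omega>. exp_neg (ereal l * walk_hitting_time (random_walk \<xi>) (- D) \<omega>) \<partial>M) = green_ratio b"
    by (simp add: v_def)
  moreover have "(\<integral>\<omega>. exp_neg (ereal l * walk_hitting_time (random_walk \<xi>) (- D) \<omega>) \<partial>M)
      = (\<integral>\<omega>. exp_neg (ereal l * walk_hitting_time (random_walk \<xi>) {x. x = b} \<omega>) \<partial>M)"
    by (rule W.discounted_hit_cong_lattice[OF on_lattice l]) (auto simp: D_def)
  ultimately show ?thesis by simp
qed

text \<open>
  The function of the point problem, used for the half-line. After passing \<open>b\<close> by at most \<open>\<epsilon> b\<close> it is
  close to \<open>1\<close>. Beyond that it is replaced by \<open>1\<close>, which alters the one-step equation only through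
  steps larger than \<open>\<epsilon> b\<close>.
\<close>

lemma expectation_half_line_hit:
  assumes walk: "walk_with_law M \<xi> \<mu>" and var: "integrable \<mu> (\<lambda>x. x\<^sup>2)"
    and b: "b / h \<in> \<int>" "b > 0" and \<epsilon>: "\<epsilon> > 0" and \<eta>: "\<eta> > 0"
  shows "\<bar>(\<integral>\<omega>. exp_neg (ereal l * walk_hitting_time (random_walk \<xi>) {x. b \<le> x} \<omega>) \<partial>M) - green_ratio b\<bar>
    \<le> (4 / \<kappa>\<^sup>2 + 1) / (\<epsilon> * b)\<^sup>2 * (\<integral>y. y\<^sup>2 * indicator {y. \<bar>y\<bar> > \<epsilon> * b} y \<partial>\<mu>) / (1 - exp (- l))
      + 4 / \<kappa>\<^sup>2 * (\<eta> + 4 * pi * (\<epsilon> * b) * sqrt l / \<eta>)"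
proof -
  interpret W: walk_with_law M \<xi> \<mu> by (rule walk)
  define D where "D = {x. x / h \<in> \<int>} \<inter> {x. x < b}"
  have D[measurable]: "D \<in> sets borel" unfolding D_def by measurable
  define v where "v x = (if x / h \<in> \<int> \<and> x \<le> b + \<epsilon> * b then green_ratio (b - x) else 1)" for x
  have v_meas[measurable]: "v \<in> borel_measurable borel"
    unfolding v_def by measurable
  have \<epsilon>b: "0 < \<epsilon> * b" using \<epsilon> b by simp
  define V where "V = 4 / \<kappa>\<^sup>2"
  have V: "0 \<le> V" by (simp add: V_def)
  have ratio: "\<bar>green_ratio y\<bar> \<le> V" for y unfolding V_def by (rule abs_green_ratio_le)
  have v_bound: "\<bar>v x\<bar> \<le> V + 1" for x
    using ratio[of "b - x"] V by (auto simp: v_def)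
  define m where "m = (\<integral>y. y\<^sup>2 * indicator {y. \<bar>y\<bar> > \<epsilon> * b} y \<partial>\<mu>)"
  have tr_int: "integrable \<mu> (\<lambda>y. y\<^sup>2 * indicator {y. \<bar>y\<bar> > \<epsilon> * b} y)"
    by (rule Bochner_Integration.integrable_bound[OF var]) (auto simp: indicator_def)
  have m: "0 \<le> m" unfolding m_def by (rule integral_nonneg_AE) auto
  define \<delta> where "\<delta> = (V + 1) / (\<epsilon> * b)\<^sup>2 * m"
  have \<delta>: "0 \<le> \<delta>" using V m by (simp add: \<delta>_def)
  have step: "\<bar>exp (- l) * (\<integral>y. v (x + y) \<partial>\<mu>) - v x\<bar> \<le> \<delta>" if "x \<in> D" for x
  proof -
    have x: "x / h \<in> \<int>" "x < b" using that by (auto simp: D_def)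
    have vx: "v x = green_ratio (b - x)" using x \<epsilon>b by (simp add: v_def)
    have v_int: "integrable \<mu> (\<lambda>y. v (x + y))"
      by (rule integrable_const_bound[where B="V + 1"]) (auto simp: v_bound)
    have r_int: "integrable \<mu> (\<lambda>y. green_ratio ((b - x) - y))"
      by (rule integrable_const_bound[where B=V]) (auto simp: ratio)
    have "\<bar>(\<integral>y. v (x + y) \<partial>\<mu>) - (\<integral>y. green_ratio ((b - x) - y) \<partial>\<mu>)\<bar>
        = \<bar>\<integral>y. v (x + y) - green_ratio ((b - x) - y) \<partial>\<mu>\<bar>"
      using v_int r_int by simp
    also have "\<dots> \<le> (\<integral>y. \<bar>v (x + y) - green_ratio ((b - x) - y)\<bar> \<partial>\<mu>)" by (rule integral_abs_bound)
    also have "\<dots> \<le> (\<integral>y. (V + 1) / (\<epsilon> * b)\<^sup>2 * (y\<^sup>2 * indicator {y. \<bar>y\<bar> > \<epsilon> * b} y) \<partial>\<mu>)"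
    proof (rule integral_mono_AE)
      show "AE y in \<mu>. \<bar>v (x + y) - green_ratio ((b - x) - y)\<bar>
          \<le> (V + 1) / (\<epsilon> * b)\<^sup>2 * (y\<^sup>2 * indicator {y. \<bar>y\<bar> > \<epsilon> * b} y)"
        using on_lattice
      proof eventually_elim
        case (elim y)
        have lat: "(x + y) / h \<in> \<int>" using elim x by (simp add: add_divide_distrib)
        have arg: "b - (x + y) = (b - x) - y" by simp
        show ?case
        proof (cases "x + y \<le> b + \<epsilon> * b")
          case True
          then have "v (x + y) = green_ratio ((b - x) - y)" using lat by (simp add: v_def arg)
          then show ?thesis using V by (simp add: indicator_def)
        next
          case False
          then have y: "\<epsilon> * b < y" using x by linarith
          have "1 \<le> y\<^sup>2 / (\<epsilon> * b)\<^sup>2"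
            using y \<epsilon>b power_mono[of "\<epsilon> * b" y 2] by (subst le_divide_eq_1_pos) auto
          then have "V + 1 \<le> (V + 1) * (y\<^sup>2 / (\<epsilon> * b)\<^sup>2)"
            using V mult_left_mono[of 1 "y\<^sup>2 / (\<epsilon> * b)\<^sup>2" "V + 1"] by simp
          moreover have "\<bar>v (x + y) - green_ratio ((b - x) - y)\<bar> \<le> V + 1"
            using False ratio[of "(b - x) - y"] by (simp add: v_def abs_le_iff)
          ultimately show ?thesis using y \<epsilon>b by simp
        qed
      qed
    qed (use v_int r_int tr_int in auto)
    also have "\<dots> = \<delta>"
      unfolding \<delta>_def m_def by (rule Bochner_Integration.integral_mult_right_zero)
    finally have diff: "\<bar>(\<integral>y. v (x + y) \<partial>\<mu>) - (\<integral>y. green_ratio ((b - x) - y) \<partial>\<mu>)\<bar> \<le> \<delta>" .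
    have "(b - x) / h \<in> \<int>" using b x by (simp add: diff_divide_distrib)
    then have harm: "exp (- l) * (\<integral>y. green_ratio ((b - x) - y) \<partial>\<mu>) = v x"
      unfolding vx using x by (intro green_ratio_harmonic) auto
    have "exp (- l) * (\<integral>y. v (x + y) \<partial>\<mu>) - v x
        = exp (- l) * ((\<integral>y. v (x + y) \<partial>\<mu>) - (\<integral>y. green_ratio ((b - x) - y) \<partial>\<mu>))"
      unfolding harm[symmetric] by (simp add: right_diff_distrib)
    also have "\<bar>\<dots>\<bar> \<le> 1 * \<delta>"
      unfolding abs_mult using l diff by (intro mult_mono) auto
    finally show ?thesis by simp
  qed
  define E where "E = 4 / \<kappa>\<^sup>2 * (\<eta> + 4 * pi * (\<epsilon> * b) * sqrt l / \<eta>)"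
  have E: "0 \<le> E"
    unfolding E_def using \<epsilon> b(2) \<eta> l
    by (intro mult_nonneg_nonneg add_nonneg_nonneg divide_nonneg_nonneg) auto
  have exit: "\<bar>v x - 1\<bar> \<le> E" if "x \<notin> D" for x
  proof (cases "x / h \<in> \<int> \<and> x \<le> b + \<epsilon> * b")
    case True
    then have "\<bar>b - x\<bar> \<le> \<epsilon> * b" using that by (auto simp: D_def)
    from green_ratio_near_0[OF this \<eta>] True show ?thesis by (simp add: v_def E_def)
  qed (use E in \<open>auto simp: v_def\<close>)
  have "\<bar>(\<integral>\<omega>. exp_neg (ereal l * walk_hitting_time (random_walk \<xi>) (- D) \<omega>) \<partial>M) - v 0\<bar>
      \<le> \<delta> / (1 - exp (- l)) + E"
    by (rule W.expectation_discounted_hit[OF v_meas D v_bound l step exit \<delta> E])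
  moreover have "v 0 = green_ratio b" using b \<epsilon>b by (simp add: v_def)
  moreover have "(\<integral>\<omega>. exp_neg (ereal l * walk_hitting_time (random_walk \<xi>) (- D) \<omega>) \<partial>M)
      = (\<integral>\<omega>. exp_neg (ereal l * walk_hitting_time (random_walk \<xi>) {x. b \<le> x} \<omega>) \<partial>M)"
    by (rule W.discounted_hit_cong_lattice[OF on_lattice l]) (auto simp: D_def)
  ultimately show ?thesis by (simp add: \<delta>_def E_def V_def m_def)
qed

end
end

lemma lattice_green_exists:
  assumes dist: "real_distribution \<mu>"
    and mean: "has_bochner_integral \<mu> (\<lambda>x. x) 0" and var: "has_bochner_integral \<mu> (\<lambda>x. x\<^sup>2) 1"
    and span: "has_lattice_span \<mu> (\<lambda>x. x) h"
  obtains \<kappa> where "\<kappa> > 0" "\<And>l. 0 < l \<Longrightarrow> l \<le> 1 \<Longrightarrow> lattice_green \<mu> h l \<kappa>"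
proof -
  interpret real_distribution \<mu> by (rule dist)
  obtain c where c: "0 < c" "c \<le> 1" "\<And>u. \<bar>u\<bar> \<le> pi / h \<Longrightarrow> c * u\<^sup>2 \<le> Re (1 - char \<mu> u)"
    using char_quadratic_lower_bound[OF mean var span] by blast
  show ?thesis
  proof (rule that[of "c / 3"])
    show "0 < c / 3" using c by simp
    fix l :: real assume l: "0 < l" "l \<le> 1"
    have split: "1 - exp (- l) * char \<mu> u = of_real (1 - exp (- l)) + of_real (exp (- l)) * (1 - char \<mu> u)" for u
      by (simp add: algebra_simps)
    have e3: "1 / 3 \<le> exp (- l)"
    proof -
      have "exp l \<le> exp 1" using l by simp
      also have "\<dots> \<le> 3" by (rule exp_le)
      finally show ?thesis by (simp add: exp_minus field_simps)
    qed
    show "lattice_green \<mu> h l (c / 3)"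
    proof
      show "0 < h" "AE x in \<mu>. x / h \<in> \<int>" using span by (auto simp: has_lattice_span_def)
      show "0 < l" "0 < c / 3" using l c by auto
      fix u
      have "cmod (1 - exp (- l) * char \<mu> u)
          \<le> cmod (of_real (1 - exp (- l))) + cmod (of_real (exp (- l)) * (1 - char \<mu> u))"
        unfolding split by (rule norm_triangle_ineq)
      also have "\<dots> = (1 - exp (- l)) + exp (- l) * cmod (1 - char \<mu> u)"
        using l by (simp only: norm_mult norm_of_real abs_exp_cancel) simp
      also have "\<dots> \<le> l + 1 * (2 * u\<^sup>2)"
        using exp_ge_add_one_self[of "- l"] l char_quadratic_bounds(1)[OF mean var, of u]
        by (intro add_mono mult_mono) auto
      also have "\<dots> \<le> 2 * (l + u\<^sup>2)" using l by simp
      finally show "cmod (1 - exp (- l) * char \<mu> u) \<le> 2 * (l + u\<^sup>2)" .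
      assume u: "\<bar>u\<bar> \<le> pi / h"
      have "c / 3 * (l + u\<^sup>2) = c * (l / 3) + 1 / 3 * (c * u\<^sup>2)" by (simp add: field_simps)
      also have "\<dots> \<le> 1 * (l / 2) + exp (- l) * Re (1 - char \<mu> u)"
        using c u l e3 by (intro add_mono mult_mono) auto
      also have "\<dots> \<le> (1 - exp (- l)) + exp (- l) * Re (1 - char \<mu> u)"
        using one_minus_exp_neg_ge[of l] l by simp
      also have "\<dots> = Re (1 - exp (- l) * char \<mu> u)"
        by (simp add: algebra_simps Re_exp Im_exp)
      finally show "c / 3 * (l + u\<^sup>2) \<le> Re (1 - exp (- l) * char \<mu> u)" .
    qed
  qed
qed

text \<open>
  Both transforms are close to the same quotient \<open>G(b) / G(0)\<close>.
\<close>

theorem lattice_point_vs_half_line: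
  assumes walk: "walk_with_law M \<xi> \<mu>"
    and mean: "has_bochner_integral \<mu> (\<lambda>x. x) 0" and var: "has_bochner_integral \<mu> (\<lambda>x. x\<^sup>2) 1"
    and span: "has_lattice_span \<mu> (\<lambda>x. x) h" and \<theta>: "\<theta> > 0"
  shows "(\<lambda>n::nat. (\<integral>\<omega>. exp_neg (ereal \<theta> * walk_hitting_time (random_walk \<xi>) {x. x = h * real n} \<omega> / ereal ((h * real n)\<^sup>2)) \<partial>M)
      - (\<integral>\<omega>. exp_neg (ereal \<theta> * walk_hitting_time (random_walk \<xi>) {x. h * real n \<le> x} \<omega> / ereal ((h * real n)\<^sup>2)) \<partial>M))
    \<longlonglongrightarrow> 0"
proof (rule LIMSEQ_I)
  fix e :: real assume e: "e > 0"
  interpret W: walk_with_law M \<xi> \<mu> by (rule walk)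
  have dist: "real_distribution \<mu>"
    unfolding real_distribution_def real_distribution_axioms_def
    using W.prob_space_law W.sets_law by simp
  have h: "h > 0" using span by (simp add: has_lattice_span_def)
  have var_int: "integrable \<mu> (\<lambda>x. x\<^sup>2)" using var by (simp add: has_bochner_integral_iff)
  obtain \<kappa> where \<kappa>: "\<kappa> > 0" "\<And>l. 0 < l \<Longrightarrow> l \<le> 1 \<Longrightarrow> lattice_green \<mu> h l \<kappa>"
    using lattice_green_exists[OF dist mean var span] by blast
  \<comment> \<open>With \<open>\<epsilon> = \<eta>\<^sup>2\<close> the deviation of \<open>G(b - x) / G(0)\<close> from \<open>1\<close> for \<open>b \<le> x \<le> b + \<epsilon> b\<close> is at most
    \<open>A \<eta>\<close>; this consumes one half of \<open>e\<close>. Long steps take the other half once \<open>b\<close> is large.\<close>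
  define A where "A = 4 / \<kappa>\<^sup>2 * (1 + 4 * pi * sqrt \<theta>)"
  have A: "A > 0"
    unfolding A_def by (rule mult_pos_pos) (use \<kappa> \<theta> in \<open>auto intro!: add_pos_nonneg\<close>)
  define \<eta> where "\<eta> = e / (2 * A)"
  have \<eta>: "\<eta> > 0" using e A by (simp add: \<eta>_def)
  define \<epsilon> where "\<epsilon> = \<eta>\<^sup>2"
  have \<epsilon>: "\<epsilon> > 0" using \<eta> by (simp add: \<epsilon>_def)
  define m where "m b = (\<integral>y. y\<^sup>2 * indicator {y. \<bar>y\<bar> > \<epsilon> * b} y \<partial>\<mu>)" for b
  define b where "b n = h * real n" for n :: nat
  have b_top: "filterlim b at_top sequentially"
    unfolding b_def using h
    by (intro filterlim_tendsto_pos_mult_at_top[OF tendsto_const] filterlim_real_sequentially)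
  have "(m \<longlongrightarrow> 0) at_top"
    unfolding m_def[abs_def] by (rule truncated_second_moment_tendsto_0[OF W.sets_law var_int \<epsilon>])
  then have "(\<lambda>n. 2 * (4 / \<kappa>\<^sup>2 + 1) / (\<epsilon>\<^sup>2 * \<theta>) * m (b n)) \<longlonglongrightarrow> 2 * (4 / \<kappa>\<^sup>2 + 1) / (\<epsilon>\<^sup>2 * \<theta>) * 0"
    by (intro tendsto_mult tendsto_const filterlim_compose[OF _ b_top])
  then have ev1: "eventually (\<lambda>n. 2 * (4 / \<kappa>\<^sup>2 + 1) / (\<epsilon>\<^sup>2 * \<theta>) * m (b n) < e / 2) sequentially"
    by (rule order_tendstoD) (use e in simp)
  have l_lim: "(\<lambda>n. \<theta> / (b n)\<^sup>2) \<longlonglongrightarrow> 0"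
    by (intro tendsto_divide_0[OF tendsto_const] filterlim_at_top_imp_at_infinity
        filterlim_compose[OF filterlim_pow_at_top b_top] filterlim_pow_at_top b_top) simp
  have ev2: "eventually (\<lambda>n. \<theta> / (b n)\<^sup>2 < min 1 ((pi / h)\<^sup>2)) sequentially"
    by (rule order_tendstoD[OF l_lim]) (use h in simp)
  have ev3: "eventually (\<lambda>n. b n > 0) sequentially"
    using b_top by (auto simp: filterlim_at_top_dense)
  have "eventually (\<lambda>n. \<bar>(\<integral>\<omega>. exp_neg (ereal \<theta> * walk_hitting_time (random_walk \<xi>) {x. x = b n} \<omega> / ereal ((b n)\<^sup>2)) \<partial>M)
      - (\<integral>\<omega>. exp_neg (ereal \<theta> * walk_hitting_time (random_walk \<xi>) {x. b n \<le> x} \<omega> / ereal ((b n)\<^sup>2)) \<partial>M)\<bar> < e) sequentially"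
    using ev1 ev2 ev3
  proof eventually_elim
    case (elim n)
    define l where "l = \<theta> / (b n)\<^sup>2"
    have rate: "0 < l" "l \<le> 1" "l \<le> (pi / h)\<^sup>2" using elim \<theta> by (auto simp: l_def)
    interpret lattice_green \<mu> h l \<kappa> by (rule \<kappa>(2)[OF rate(1,2)])
    have low: "sqrt l \<le> pi / h" using rate(3) h by (intro real_le_lsqrt) auto
    have lat: "b n / h \<in> \<int>" using h by (simp add: b_def)
    have sql: "b n * sqrt l = sqrt \<theta>" using elim by (simp add: l_def real_sqrt_divide)
    have exact: "(\<integral>\<omega>. exp_neg (ereal l * walk_hitting_time (random_walk \<xi>) {x. x = b n} \<omega>) \<partial>M) = green_ratio (b n)"
      by (rule expectation_point_hit[OF low walk lat])
    have "\<bar>(\<integral>\<omega>. exp_neg (ereal l * walk_hitting_time (random_walk \<xi>) {x. b n \<le> x} \<omega>) \<partial>M) - green_ratio (b n)\<bar>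
        \<le> (4 / \<kappa>\<^sup>2 + 1) / (\<epsilon> * b n)\<^sup>2 * m (b n) / (1 - exp (- l))
          + 4 / \<kappa>\<^sup>2 * (\<eta> + 4 * pi * (\<epsilon> * b n) * sqrt l / \<eta>)"
      unfolding m_def by (rule expectation_half_line_hit[OF low walk var_int lat elim(3) \<epsilon> \<eta>])
    also have "\<dots> \<le> (4 / \<kappa>\<^sup>2 + 1) / (\<epsilon> * b n)\<^sup>2 * m (b n) / (l / 2)
          + 4 / \<kappa>\<^sup>2 * (\<eta> + 4 * pi * (\<epsilon> * b n) * sqrt l / \<eta>)"
    proof (intro add_right_mono divide_left_mono)
      show "l / 2 \<le> 1 - exp (- l)" using one_minus_exp_neg_ge[of l] rate by simp
      have "0 \<le> m (b n)" unfolding m_def by (rule integral_nonneg_AE) auto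
      then show "0 \<le> (4 / \<kappa>\<^sup>2 + 1) / (\<epsilon> * b n)\<^sup>2 * m (b n)" by simp
    qed (use rate in auto)
    also have "(4 / \<kappa>\<^sup>2 + 1) / (\<epsilon> * b n)\<^sup>2 * m (b n) / (l / 2) = 2 * (4 / \<kappa>\<^sup>2 + 1) / (\<epsilon>\<^sup>2 * \<theta>) * m (b n)"
      using elim(3) \<theta> by (simp add: l_def power_mult_distrib)
    also have "4 * pi * (\<epsilon> * b n) * sqrt l / \<eta> = 4 * pi * sqrt \<theta> * \<eta>"
      unfolding sql[symmetric] using \<eta> by (simp add: \<epsilon>_def power2_eq_square)
    also have "4 / \<kappa>\<^sup>2 * (\<eta> + 4 * pi * sqrt \<theta> * \<eta>) = A * \<eta>" by (simp add: A_def algebra_simps)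
    also have "A * \<eta> = e / 2" using A by (simp add: \<eta>_def)
    also have "2 * (4 / \<kappa>\<^sup>2 + 1) / (\<epsilon>\<^sup>2 * \<theta>) * m (b n) + e / 2 < e" using elim(1) by linarith
    finally have "\<bar>(\<integral>\<omega>. exp_neg (ereal l * walk_hitting_time (random_walk \<xi>) {x. b n \<le> x} \<omega>) \<partial>M) - green_ratio (b n)\<bar> < e" .
    then show ?case
      unfolding exact[symmetric] using elim(3)
      by (simp add: scaled_hitting_time l_def[symmetric] abs_minus_commute)
  qed
  then show "\<exists>n0. \<forall>n\<ge>n0. norm ((\<integral>\<omega>. exp_neg (ereal \<theta> * walk_hitting_time (random_walk \<xi>) {x. x = h * real n} \<omega> / ereal ((h * real n)\<^sup>2)) \<partial>M)
      - (\<integral>\<omega>. exp_neg (ereal \<theta> * walk_hitting_time (random_walk \<xi>) {x. h * real n \<le> x} \<omega> / ereal ((h * real n)\<^sup>2)) \<partial>M) - 0) < e"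
    by (simp add: b_def eventually_sequentially)
qed

section \<open>Limits of the Laplace transforms\<close>

lemma walk_with_law_of_iid:
  assumes "iid_standardized M \<xi>"
  shows "walk_with_law M \<xi> (distr M borel (\<xi> 1))"
    and "has_bochner_integral (distr M borel (\<xi> 1)) (\<lambda>x. x) 0"
    and "has_bochner_integral (distr M borel (\<xi> 1)) (\<lambda>x. x\<^sup>2) 1"
proof -
  have prob: "prob_space M" and ind: "prob_space.indep_vars M (\<lambda>_. borel) \<xi> {1..}"
    and law: "\<And>i. i \<ge> 1 \<Longrightarrow> distr M borel (\<xi> i) = distr M borel (\<xi> 1)"
    and mean: "has_bochner_integral M (\<xi> 1) 0" and var: "has_bochner_integral M (\<lambda>\<omega>. (\<xi> 1 \<omega>)\<^sup>2) 1"
    using assms unfolding iid_standardized_def by (blast intro: order_refl)+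
  show "walk_with_law M \<xi> (distr M borel (\<xi> 1))"
    unfolding walk_with_law_def walk_with_law_axioms_def using prob ind law by blast
  have [measurable]: "\<xi> 1 \<in> borel_measurable M"
    using mean by (rule borel_measurable_has_bochner_integral)
  show "has_bochner_integral (distr M borel (\<xi> 1)) (\<lambda>x. x) 0"
    and "has_bochner_integral (distr M borel (\<xi> 1)) (\<lambda>x. x\<^sup>2) 1"
    using mean var by (auto simp: has_bochner_integral_iff integrable_distr_eq integral_distr)
qed

theorem theorem7:
  fixes M :: "'a measure" and \<xi> :: "nat \<Rightarrow> 'a \<Rightarrow> real"
    and N :: "'b measure" and W :: "real \<Rightarrow> 'b \<Rightarrow> real"
    and \<tau> \<sigma> \<sigma>_ge :: "real \<Rightarrow> 'a \<Rightarrow> ereal" and T S :: "'b \<Rightarrow> ereal"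
    and \<theta> :: real
  assumes iid: "iid_standardized M \<xi>"
    and BM: "standard_brownian_motion N W"
    and \<tau>: "\<tau> = (\<lambda>b. walk_hitting_time (random_walk \<xi>) {x. \<bar>x\<bar> \<ge> b})"
    and \<sigma>: "\<sigma> = (\<lambda>b. walk_hitting_time (random_walk \<xi>) {x. x = b})"
    and \<sigma>_ge: "\<sigma>_ge = (\<lambda>b. walk_hitting_time (random_walk \<xi>) {x. x \<ge> b})"
    and T: "T = process_hitting_time W {x. \<bar>x\<bar> = 1}"
    and S: "S = process_hitting_time W {x. x = 1}"
    and \<theta>: "\<theta> > 0"
  shows "((\<lambda>b. \<integral>\<omega>. exp_neg (ereal \<theta> * \<tau> b \<omega> / ereal (b\<^sup>2)) \<partial>M)
            \<longlongrightarrow> (\<integral>\<omega>. exp_neg (ereal \<theta> * T \<omega>) \<partial>N)) at_top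
    \<and> (\<integral>\<omega>. exp_neg (ereal \<theta> * T \<omega>) \<partial>N) = sech (sqrt (2 * \<theta>))
    \<and> ((\<lambda>b. \<integral>\<omega>. exp_neg (ereal \<theta> * \<sigma>_ge b \<omega> / ereal (b\<^sup>2)) \<partial>M)
            \<longlongrightarrow> (\<integral>\<omega>. exp_neg (ereal \<theta> * S \<omega>) \<partial>N)) at_top
    \<and> (\<forall>h. has_lattice_span M (\<xi> 1) h \<longrightarrow>
          (\<lambda>n::nat. \<integral>\<omega>. exp_neg (ereal \<theta> * \<sigma> (h * real n) \<omega> / ereal ((h * real n)\<^sup>2)) \<partial>M)
            \<longlonglongrightarrow> (\<integral>\<omega>. exp_neg (ereal \<theta> * S \<omega>) \<partial>N))
    \<and> (\<integral>\<omega>. exp_neg (ereal \<theta> * S \<omega>) \<partial>N) = exp (- sqrt (2 * \<theta>))"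
proof -
  define \<mu> where "\<mu> = distr M borel (\<xi> 1)"
  have walk: "walk_with_law M \<xi> \<mu>" and mean: "has_bochner_integral \<mu> (\<lambda>x. x) 0"
    and var: "has_bochner_integral \<mu> (\<lambda>x. x\<^sup>2) 1"
    unfolding \<mu>_def by (rule walk_with_law_of_iid[OF iid])+
  interpret walk_with_law M \<xi> \<mu> by (rule walk)
  note \<mu> = prob_space_law sets_law mean var \<theta>
  note gauss = std_normal_moments
  have ET: "(\<integral>\<omega>. exp_neg (ereal \<theta> * T \<omega>) \<partial>N) = sech (sqrt (2 * \<theta>))"
    unfolding T
  proof (rule brownian_hitting_transform[where p=abs and L="\<lambda>\<theta>. sech (sqrt (2 * \<theta>))", OF BM _ _ _ \<theta>])
    show "isCont (\<lambda>\<theta>. sech (sqrt (2 * \<theta>))) \<theta>"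
      unfolding sech_def by (intro continuous_intros) (simp add: cosh_real_pos less_imp_neq[symmetric])
  next
    show "continuous_on UNIV (abs :: real \<Rightarrow> real)" by (intro continuous_intros)
  qed (auto simp: abs_mult intro: two_sided_transform_limit[OF gauss])
  have ES: "(\<integral>\<omega>. exp_neg (ereal \<theta> * S \<omega>) \<partial>N) = exp (- sqrt (2 * \<theta>))"
    unfolding S
  proof (rule brownian_hitting_transform[where p="\<lambda>x. x" and L="\<lambda>\<theta>. exp (- sqrt (2 * \<theta>))", OF BM _ _ _ \<theta>])
    show "isCont (\<lambda>\<theta>. exp (- sqrt (2 * \<theta>))) \<theta>" by (intro continuous_intros)
  qed (auto intro: one_sided_transform_limit[OF gauss])
  have \<tau>_lim: "((\<lambda>b. \<integral>\<omega>. exp_neg (ereal \<theta> * \<tau> b \<omega> / ereal (b\<^sup>2)) \<partial>M) \<longlongrightarrow> sech (sqrt (2 * \<theta>))) at_top"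
    unfolding \<tau> by (rule two_sided_transform_limit[OF \<mu> walk filterlim_ident])
  have \<sigma>_ge_lim: "((\<lambda>i. \<integral>\<omega>. exp_neg (ereal \<theta> * \<sigma>_ge (b i) \<omega> / ereal ((b i)\<^sup>2)) \<partial>M)
      \<longlongrightarrow> exp (- sqrt (2 * \<theta>))) F"
    if "filterlim b at_top F" for b :: "'i \<Rightarrow> real" and F
    unfolding \<sigma>_ge by (rule one_sided_transform_limit[OF \<mu> walk that])
  have \<sigma>_lim: "(\<lambda>n::nat. \<integral>\<omega>. exp_neg (ereal \<theta> * \<sigma> (h * real n) \<omega> / ereal ((h * real n)\<^sup>2)) \<partial>M)
      \<longlonglongrightarrow> exp (- sqrt (2 * \<theta>))" if "has_lattice_span M (\<xi> 1) h" for h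
  proof -
    have span: "has_lattice_span \<mu> (\<lambda>x. x) h"
      unfolding \<mu>_def using that steps_measurable[of 1] by (simp add: has_lattice_span_distr)
    have "filterlim (\<lambda>n. h * real n) at_top sequentially"
      using that by (intro filterlim_tendsto_pos_mult_at_top[OF tendsto_const] filterlim_real_sequentially)
        (simp add: has_lattice_span_def)
    from tendsto_add[OF lattice_point_vs_half_line[OF walk mean var span \<theta>] \<sigma>_ge_lim[OF this]]
    show ?thesis unfolding \<sigma> \<sigma>_ge by simp
  qed
  show ?thesis
    using \<tau>_lim \<sigma>_ge_lim[OF filterlim_ident] \<sigma>_lim unfolding ET ES by simp
qed

end
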